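(* Let $n\ge 2$. The natural embedding of the Artin braid group $B_n$ into the virtual braid group $VB_n$ (sending the standard generators $\sigma_i$ to $\sigma_i$) induces an embedding (injective homomorphism) of $B_n/\Gamma_2(P_n)$ into $VB_n/\Gamma_2(VP_n)$.
   Context: $\Gamma_2(H)=[H,H]$ is the commutator subgroup of $H$. $B_n$ is the Artin braid group on $n$ strands and $P_n$ the pure Artin braid group, the kernel of $B_n\to S_n$, $\sigma_i\mapsto(i,i+1)$. $VB_n$ is the group with generators $\sigma_i,\rho_i$ ($1\le i\le n-1$) and relations: $\sigma_i\sigma_{i+1}\sigma_i=\sigma_{i+1}\sigma_i\sigma_{i+1}$, $\rho_i\rho_{i+1}\rho_i=\rho_{i+1}\rho_i\rho_{i+1}$, $\rho_i\rho_{i+1}\sigma_i=\sigma_{i+1}\rho_i\rho_{i+1}$ for $1\le i\le n-2$; $\rho_i^2=1$ for $1\le i\le n-1$; and $\sigma_i\sigma_j=\sigma_j\sigma_i$, $\rho_i\rho_j=\rho_j\rho_i$, $\sigma_i\rho_j=\rho_j\sigma_i$ for $|i-j|\ge 2$. $VP_n$ is the kernel of the homomorphism $VB_n\to S_n$, $\sigma_i,\rho_i\mapsto (i,i+1)$. It is known that $\sigma_i\mapsto\sigma_i$ defines an injective homomorphism $B_n\to VB_n$. *)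

theory Defs
  imports "HOL-Algebra.Sym_Groups"
begin

section \<open>Groups given by generators and relations\<close>

text \<open>
  A word is a list of letters; the letter \<open>(x, True)\<close> stands for the generator \<open>x\<close> and
  \<open>(x, False)\<close> for its formal inverse. A presentation consists of a set \<open>X\<close> of generators and
  a set \<open>R\<close> of pairs \<open>(u, v)\<close> of words, read as relations \<open>u = v\<close>. The group it presents is the
  quotient of the words over \<open>X\<close> by the least congruence that contains \<open>R\<close> and free cancellation.
\<close>

type_synonym 'g word = "('g \<times> bool) list"

definition gen_words :: "'g set \<Rightarrow> 'g word set" where
  "gen_words X = {w. fst ` set w \<subseteq> X}"

inductive pres_eq :: "'g set \<Rightarrow> ('g word \<times> 'g word) set \<Rightarrow> 'g word \<Rightarrow> 'g word \<Rightarrow> bool"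
  for X :: "'g set" and R :: "('g word \<times> 'g word) set" where
  refl: "u \<in> gen_words X \<Longrightarrow> pres_eq X R u u"
| sym: "pres_eq X R u v \<Longrightarrow> pres_eq X R v u"
| trans: "pres_eq X R u v \<Longrightarrow> pres_eq X R v w \<Longrightarrow> pres_eq X R u w"
| append: "pres_eq X R u v \<Longrightarrow> pres_eq X R u' v' \<Longrightarrow> pres_eq X R (u @ u') (v @ v')"
| cancel: "x \<in> X \<Longrightarrow> pres_eq X R [(x, b), (x, \<not> b)] []"
| rel: "(u, v) \<in> R \<Longrightarrow> u \<in> gen_words X \<Longrightarrow> v \<in> gen_words X \<Longrightarrow> pres_eq X R u v"

definition pres_class :: "'g set \<Rightarrow> ('g word \<times> 'g word) set \<Rightarrow> 'g word \<Rightarrow> 'g word set" where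
  "pres_class X R u = {v. pres_eq X R u v}"

definition pres_group :: "'g set \<Rightarrow> ('g word \<times> 'g word) set \<Rightarrow> 'g word set monoid" where
  "pres_group X R =
     \<lparr> carrier = pres_class X R ` gen_words X,
       mult = (\<lambda>A B. \<Union>u\<in>A. \<Union>v\<in>B. pres_class X R (u @ v)),
       one = pres_class X R [] \<rparr>"

definition gen_class :: "'g set \<Rightarrow> ('g word \<times> 'g word) set \<Rightarrow> 'g \<Rightarrow> 'g word set" where
  "gen_class X R x = pres_class X R [(x, True)]"

fun word_eval :: "('a, 'b) monoid_scheme \<Rightarrow> ('g \<Rightarrow> 'a) \<Rightarrow> 'g word \<Rightarrow> 'a" where
  "word_eval G f [] = \<one>\<^bsub>G\<^esub>"
| "word_eval G f ((x, b) # w) = (if b then f x else inv\<^bsub>G\<^esub> (f x)) \<otimes>\<^bsub>G\<^esub> word_eval G f w"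

text \<open>
  The map out of a presented group determined by the images \<open>f x\<close> of the generators. It is only
  meaningful when \<open>f\<close> respects the relations (lemma \<open>pres_hom\<close>): then \<open>word_eval G f\<close> is constant
  on each class, which is what \<open>the_elem\<close> relies on.
\<close>

definition pres_lift :: "('a, 'b) monoid_scheme \<Rightarrow> ('g \<Rightarrow> 'a) \<Rightarrow> 'g word set \<Rightarrow> 'a" where
  "pres_lift G f A = the_elem (word_eval G f ` A)"

subsection \<open>Presented groups are groups\<close>

lemma gen_words_simps [simp]:
  "[] \<in> gen_words X"
  "a # u \<in> gen_words X \<longleftrightarrow> fst a \<in> X \<and> u \<in> gen_words X"
  "u @ v \<in> gen_words X \<longleftrightarrow> u \<in> gen_words X \<and> v \<in> gen_words X"
  by (auto simp: gen_words_def)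

lemma pres_eq_in_words:
  "pres_eq X R u v \<Longrightarrow> u \<in> gen_words X \<and> v \<in> gen_words X"
  by (induction rule: pres_eq.induct) auto

lemma pres_class_eq_iff:
  assumes "u \<in> gen_words X"
  shows "pres_class X R u = pres_class X R v \<longleftrightarrow> pres_eq X R u v"
proof
  assume "pres_class X R u = pres_class X R v"
  then have "u \<in> pres_class X R v"
    using assms by (auto simp: pres_class_def intro: pres_eq.refl)
  then show "pres_eq X R u v"
    by (auto simp: pres_class_def intro: pres_eq.sym)
next
  assume "pres_eq X R u v"
  then show "pres_class X R u = pres_class X R v"
    by (auto simp: pres_class_def intro: pres_eq.trans pres_eq.sym)
qed

lemma pres_class_mult:
  assumes "u \<in> gen_words X" "v \<in> gen_words X"
  shows "pres_class X R u \<otimes>\<^bsub>pres_group X R\<^esub> pres_class X R v = pres_class X R (u @ v)"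
proof -
  have "pres_class X R (u' @ v') = pres_class X R (u @ v)"
    if "u' \<in> pres_class X R u" "v' \<in> pres_class X R v" for u' v'
    using that assms pres_class_eq_iff[of "u @ v" X R "u' @ v'"]
    by (auto simp: pres_class_def[of _ _ u] pres_class_def[of _ _ v] intro: pres_eq.append)
  moreover have "u \<in> pres_class X R u" "v \<in> pres_class X R v"
    using assms by (auto simp: pres_class_def intro: pres_eq.refl)
  ultimately have "(\<Union>u'\<in>pres_class X R u. \<Union>v'\<in>pres_class X R v. pres_class X R (u' @ v')) =
      pres_class X R (u @ v)"
    by blast
  then show ?thesis
    by (simp add: pres_group_def)
qed

lemma pres_group_carrier: "carrier (pres_group X R) = pres_class X R ` gen_words X"
  by (simp add: pres_group_def)

lemma pres_group_one: "\<one>\<^bsub>pres_group X R\<^esub> = pres_class X R []"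
  by (simp add: pres_group_def)

lemma pres_eq_left_inverse:
  assumes "u \<in> gen_words X"
  shows "\<exists>v \<in> gen_words X. pres_eq X R (v @ u) []"
  using assms
proof (induction u)
  case Nil
  show ?case by (rule bexI[of _ "[]"]) (auto intro: pres_eq.refl)
next
  case (Cons a u)
  obtain x b where a: "a = (x, b)" by (cases a)
  have x: "x \<in> X" and u: "u \<in> gen_words X" using Cons.prems a by auto
  from Cons.IH[OF u] obtain v where v: "v \<in> gen_words X" "pres_eq X R (v @ u) []" by blast
  have "pres_eq X R ([(x, \<not> b), (x, b)] @ u) ([] @ u)"
    using pres_eq.cancel[OF x, of R "\<not> b"] u by (intro pres_eq.append pres_eq.refl) auto
  then have "pres_eq X R (v @ [(x, \<not> b), (x, b)] @ u) (v @ [] @ u)"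
    using pres_eq.append[OF pres_eq.refl[OF v(1)]] by blast
  then have "pres_eq X R ((v @ [(x, \<not> b)]) @ a # u) []"
    using v(2) a by (auto intro: pres_eq.trans)
  then show ?case
    using v(1) x by (intro bexI[of _ "v @ [(x, \<not> b)]"]) auto
qed

lemma group_pres_group: "group (pres_group X R)"
proof (rule groupI)
  fix A assume "A \<in> carrier (pres_group X R)"
  then obtain u where u: "u \<in> gen_words X" "A = pres_class X R u"
    by (auto simp: pres_group_carrier)
  from pres_eq_left_inverse[OF u(1)] obtain v
    where v: "v \<in> gen_words X" "pres_eq X R (v @ u) []" by blast
  have "pres_class X R v \<otimes>\<^bsub>pres_group X R\<^esub> A = \<one>\<^bsub>pres_group X R\<^esub>"
    using u v pres_class_eq_iff[of "v @ u" X R "[]"]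
    by (simp add: pres_class_mult pres_group_one)
  then show "\<exists>B \<in> carrier (pres_group X R). B \<otimes>\<^bsub>pres_group X R\<^esub> A = \<one>\<^bsub>pres_group X R\<^esub>"
    using v(1) by (auto simp: pres_group_carrier)
qed (auto simp: pres_group_carrier pres_class_mult pres_group_one)

lemma gen_class_closed: "x \<in> X \<Longrightarrow> gen_class X R x \<in> carrier (pres_group X R)"
  by (auto simp: gen_class_def pres_group_carrier)

lemma gen_class_rel:
  assumes "(map (\<lambda>x. (x, True)) xs, map (\<lambda>x. (x, True)) ys) \<in> R" "set xs \<subseteq> X" "set ys \<subseteq> X"
  shows "word_eval (pres_group X R) (gen_class X R) (map (\<lambda>x. (x, True)) xs) =
         word_eval (pres_group X R) (gen_class X R) (map (\<lambda>x. (x, True)) ys)"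
proof -
  have words: "map (\<lambda>x. (x, True)) zs \<in> gen_words X" if "set zs \<subseteq> X" for zs
    using that by (induction zs) auto
  have "word_eval (pres_group X R) (gen_class X R) (map (\<lambda>x. (x, True)) zs) =
        pres_class X R (map (\<lambda>x. (x, True)) zs)" if "set zs \<subseteq> X" for zs
    using that words by (induction zs) (auto simp: pres_group_one gen_class_def pres_class_mult)
  then show ?thesis
    using assms words pres_class_eq_iff pres_eq.rel by metis
qed

subsection \<open>The universal property\<close>

context group
begin

lemma word_eval_closed:
  assumes "f \<in> X \<rightarrow> carrier G" "u \<in> gen_words X"
  shows "word_eval G f u \<in> carrier G"
  using assms(2)
proof (induction u)
  case (Cons a u)
  then show ?case using assms(1) by (cases a) auto
qed simp

lemma word_eval_append:
  assumes "f \<in> X \<rightarrow> carrier G" "u \<in> gen_words X" "v \<in> gen_words X"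
  shows "word_eval G f (u @ v) = word_eval G f u \<otimes> word_eval G f v"
  using assms(2)
proof (induction u)
  case Nil
  then show ?case using word_eval_closed[OF assms(1,3)] by simp
next
  case (Cons a u)
  then show ?case
    using assms(1) word_eval_closed[OF assms(1)] assms(3) by (cases a) (auto simp: m_assoc Pi_iff)
qed

lemma word_eval_pres_eq:
  assumes f: "f \<in> X \<rightarrow> carrier G"
    and R: "\<And>u v. (u, v) \<in> R \<Longrightarrow> word_eval G f u = word_eval G f v"
    and "pres_eq X R u v"
  shows "word_eval G f u = word_eval G f v"
  using assms(3)
proof (induction rule: pres_eq.induct)
  case (append u v u' v')
  then show ?case
    using word_eval_append[OF f] pres_eq_in_words by metis
next
  case (cancel x b)
  then show ?case using f by (auto simp: Pi_iff)
qed (auto dest: R)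

lemma pres_lift_class:
  assumes "f \<in> X \<rightarrow> carrier G"
    and "\<And>u v. (u, v) \<in> R \<Longrightarrow> word_eval G f u = word_eval G f v"
    and "u \<in> gen_words X"
  shows "pres_lift G f (pres_class X R u) = word_eval G f u"
proof -
  have "u \<in> pres_class X R u"
    using assms(3) by (auto simp: pres_class_def intro: pres_eq.refl)
  moreover have "word_eval G f v = word_eval G f u" if "v \<in> pres_class X R u" for v
    using word_eval_pres_eq[OF assms(1,2), of R u v] that by (auto simp: pres_class_def)
  ultimately have "word_eval G f ` pres_class X R u = {word_eval G f u}" by blast
  then show ?thesis by (simp add: pres_lift_def)
qed

lemma pres_hom:
  assumes "f \<in> X \<rightarrow> carrier G"
    and "\<And>u v. (u, v) \<in> R \<Longrightarrow> word_eval G f u = word_eval G f v"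
  shows "pres_lift G f \<in> hom (pres_group X R) G"
  using pres_lift_class[OF assms] word_eval_closed[OF assms(1)] word_eval_append[OF assms(1)]
  by (auto simp: hom_def pres_group_carrier pres_class_mult)

lemma pres_lift_gen:
  assumes "f \<in> X \<rightarrow> carrier G"
    and "\<And>u v. (u, v) \<in> R \<Longrightarrow> word_eval G f u = word_eval G f v"
    and "x \<in> X"
  shows "pres_lift G f (gen_class X R x) = f x"
  using pres_lift_class[OF assms(1,2), of R "[(x, True)]"] assms(1,3)
  by (auto simp: gen_class_def Pi_iff)

end

section \<open>Braid groups and virtual braid groups\<close>

text \<open>
  In the index ranges below, truncated subtraction on the natural numbers is
  harmless: for small \<open>n\<close> the intervals \<open>{1..n-1}\<close> and \<open>{1..n-2}\<close> are empty, as they should be.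
\<close>

abbreviation pos_word :: "'g list \<Rightarrow> 'g word" where
  "pos_word xs \<equiv> map (\<lambda>x. (x, True)) xs"

definition braid_gens :: "nat \<Rightarrow> nat set" where
  "braid_gens n = {1..n-1}"

definition braid_rels :: "nat \<Rightarrow> (nat word \<times> nat word) set" where
  "braid_rels n =
     {(pos_word [i, i+1, i], pos_word [i+1, i, i+1]) | i. i \<in> {1..n-2}} \<union>
     {(pos_word [i, j], pos_word [j, i]) | i j.
        i \<in> {1..n-1} \<and> j \<in> {1..n-1} \<and> \<bar>int i - int j\<bar> \<ge> 2}"

definition braid_group :: "nat \<Rightarrow> nat word set monoid" where
  "braid_group n = pres_group (braid_gens n) (braid_rels n)"

datatype vgen = VSigma nat | VRho nat

definition vbraid_gens :: "nat \<Rightarrow> vgen set" where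
  "vbraid_gens n = VSigma ` {1..n-1} \<union> VRho ` {1..n-1}"

definition vbraid_rels :: "nat \<Rightarrow> (vgen word \<times> vgen word) set" where
  "vbraid_rels n =
     {(pos_word [VSigma i, VSigma (i+1), VSigma i],
       pos_word [VSigma (i+1), VSigma i, VSigma (i+1)]) | i. i \<in> {1..n-2}} \<union>
     {(pos_word [VRho i, VRho (i+1), VRho i],
       pos_word [VRho (i+1), VRho i, VRho (i+1)]) | i. i \<in> {1..n-2}} \<union>
     {(pos_word [VRho i, VRho (i+1), VSigma i],
       pos_word [VSigma (i+1), VRho i, VRho (i+1)]) | i. i \<in> {1..n-2}} \<union>
     {(pos_word [VRho i, VRho i], []) | i. i \<in> {1..n-1}} \<union>
     {(pos_word [VSigma i, VSigma j], pos_word [VSigma j, VSigma i]) | i j.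
        i \<in> {1..n-1} \<and> j \<in> {1..n-1} \<and> \<bar>int i - int j\<bar> \<ge> 2} \<union>
     {(pos_word [VRho i, VRho j], pos_word [VRho j, VRho i]) | i j.
        i \<in> {1..n-1} \<and> j \<in> {1..n-1} \<and> \<bar>int i - int j\<bar> \<ge> 2} \<union>
     {(pos_word [VSigma i, VRho j], pos_word [VRho j, VSigma i]) | i j.
        i \<in> {1..n-1} \<and> j \<in> {1..n-1} \<and> \<bar>int i - int j\<bar> \<ge> 2}"

definition vbraid_group :: "nat \<Rightarrow> vgen word set monoid" where
  "vbraid_group n = pres_group (vbraid_gens n) (vbraid_rels n)"

definition braid_sigma :: "nat \<Rightarrow> nat \<Rightarrow> nat word set" where
  "braid_sigma n i = gen_class (braid_gens n) (braid_rels n) i"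

definition vbraid_sigma :: "nat \<Rightarrow> nat \<Rightarrow> vgen word set" where
  "vbraid_sigma n i = gen_class (vbraid_gens n) (vbraid_rels n) (VSigma i)"

definition vbraid_rho :: "nat \<Rightarrow> nat \<Rightarrow> vgen word set" where
  "vbraid_rho n i = gen_class (vbraid_gens n) (vbraid_rels n) (VRho i)"

definition braid_perm :: "nat \<Rightarrow> nat word set \<Rightarrow> nat \<Rightarrow> nat" where
  "braid_perm n = pres_lift (sym_group n) (\<lambda>i. transpose i (i + 1))"

definition vbraid_perm :: "nat \<Rightarrow> vgen word set \<Rightarrow> nat \<Rightarrow> nat" where
  "vbraid_perm n = pres_lift (sym_group n)
     (case_vgen (\<lambda>i. transpose i (i + 1)) (\<lambda>i. transpose i (i + 1)))"

definition pure_braid :: "nat \<Rightarrow> nat word set set" where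
  "pure_braid n = kernel (braid_group n) (sym_group n) (braid_perm n)"

definition pure_vbraid :: "nat \<Rightarrow> vgen word set set" where
  "pure_vbraid n = kernel (vbraid_group n) (sym_group n) (vbraid_perm n)"

definition braid_to_vbraid :: "nat \<Rightarrow> nat word set \<Rightarrow> vgen word set" where
  "braid_to_vbraid n = pres_lift (vbraid_group n) (vbraid_sigma n)"

subsection \<open>The maps and quotients are well defined\<close>

lemma group_braid_group: "group (braid_group n)"
  by (simp add: braid_group_def group_pres_group)

lemma group_vbraid_group: "group (vbraid_group n)"
  by (simp add: vbraid_group_def group_pres_group)

lemma transpose_in_sym_group:
  "i \<in> {1..n-1} \<Longrightarrow> transpose i (i + 1) \<in> carrier (sym_group n)"
  by (auto simp: sym_group_carrier intro: permutes_swap_id)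

lemma braid_perm_wf:
  "(\<lambda>i. transpose i (i + 1)) \<in> braid_gens n \<rightarrow> carrier (sym_group n)"
  "(u, v) \<in> braid_rels n \<Longrightarrow>
     word_eval (sym_group n) (\<lambda>i. transpose i (i + 1)) u =
     word_eval (sym_group n) (\<lambda>i. transpose i (i + 1)) v"
proof -
  show "(\<lambda>i. transpose i (i + 1)) \<in> braid_gens n \<rightarrow> carrier (sym_group n)"
    unfolding braid_gens_def using transpose_in_sym_group by blast
  show "word_eval (sym_group n) (\<lambda>i. transpose i (i + 1)) u =
      word_eval (sym_group n) (\<lambda>i. transpose i (i + 1)) v" if "(u, v) \<in> braid_rels n"
    using that
    by (auto simp: braid_rels_def sym_group_mult sym_group_one fun_eq_iff transpose_def)
qed

lemma vbraid_perm_wf: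
  "case_vgen (\<lambda>i. transpose i (i + 1)) (\<lambda>i. transpose i (i + 1))
     \<in> vbraid_gens n \<rightarrow> carrier (sym_group n)"
  "(u, v) \<in> vbraid_rels n \<Longrightarrow>
     word_eval (sym_group n) (case_vgen (\<lambda>i. transpose i (i + 1)) (\<lambda>i. transpose i (i + 1))) u =
     word_eval (sym_group n) (case_vgen (\<lambda>i. transpose i (i + 1)) (\<lambda>i. transpose i (i + 1))) v"
proof -
  show "case_vgen (\<lambda>i. transpose i (i + 1)) (\<lambda>i. transpose i (i + 1))
      \<in> vbraid_gens n \<rightarrow> carrier (sym_group n)"
    unfolding vbraid_gens_def using transpose_in_sym_group by fastforce
  show "word_eval (sym_group n) (case_vgen (\<lambda>i. transpose i (i + 1)) (\<lambda>i. transpose i (i + 1))) u =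
      word_eval (sym_group n) (case_vgen (\<lambda>i. transpose i (i + 1)) (\<lambda>i. transpose i (i + 1))) v"
    if "(u, v) \<in> vbraid_rels n"
    using that
    by (auto simp: vbraid_rels_def sym_group_mult sym_group_one fun_eq_iff transpose_def)
qed

lemma group_hom_braid_perm: "group_hom (braid_group n) (sym_group n) (braid_perm n)"
  using group.pres_hom[OF sym_group_is_group braid_perm_wf] group_braid_group sym_group_is_group
  by (simp add: group_hom_def group_hom_axioms_def braid_perm_def braid_group_def)

lemma braid_perm_sigma:
  "i \<in> {1..n-1} \<Longrightarrow> braid_perm n (braid_sigma n i) = transpose i (i + 1)"
  using group.pres_lift_gen[OF sym_group_is_group braid_perm_wf]
  by (simp add: braid_perm_def braid_sigma_def braid_gens_def)

lemma group_hom_vbraid_perm: "group_hom (vbraid_group n) (sym_group n) (vbraid_perm n)"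
  using group.pres_hom[OF sym_group_is_group vbraid_perm_wf] group_vbraid_group sym_group_is_group
  by (simp add: group_hom_def group_hom_axioms_def vbraid_perm_def vbraid_group_def)

lemma vbraid_perm_gens:
  assumes "i \<in> {1..n-1}"
  shows "vbraid_perm n (vbraid_sigma n i) = transpose i (i + 1)"
    and "vbraid_perm n (vbraid_rho n i) = transpose i (i + 1)"
  using group.pres_lift_gen[OF sym_group_is_group vbraid_perm_wf] assms
  by (simp_all add: vbraid_perm_def vbraid_sigma_def vbraid_rho_def vbraid_gens_def)

lemma braid_to_vbraid_wf:
  "vbraid_sigma n \<in> braid_gens n \<rightarrow> carrier (vbraid_group n)"
  "(u, v) \<in> braid_rels n \<Longrightarrow>
     word_eval (vbraid_group n) (vbraid_sigma n) u = word_eval (vbraid_group n) (vbraid_sigma n) v"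
proof -
  show "vbraid_sigma n \<in> braid_gens n \<rightarrow> carrier (vbraid_group n)"
    by (auto simp: braid_gens_def vbraid_sigma_def vbraid_group_def vbraid_gens_def
        intro!: gen_class_closed)
  have *: "word_eval (vbraid_group n) (vbraid_sigma n) (pos_word xs) =
      word_eval (vbraid_group n) (vbraid_sigma n) (pos_word ys)"
    if "(pos_word (map VSigma xs), pos_word (map VSigma ys)) \<in> vbraid_rels n"
      "set xs \<subseteq> {1..n-1}" "set ys \<subseteq> {1..n-1}" for xs ys
  proof -
    have "word_eval (vbraid_group n) (vbraid_sigma n) (pos_word zs) =
        word_eval (pres_group (vbraid_gens n) (vbraid_rels n))
          (gen_class (vbraid_gens n) (vbraid_rels n)) (pos_word (map VSigma zs))" for zs
      by (induction zs) (auto simp: vbraid_group_def vbraid_sigma_def)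
    moreover have "set (map VSigma zs) \<subseteq> vbraid_gens n" if "set zs \<subseteq> {1..n-1}" for zs
      using that by (auto simp: vbraid_gens_def)
    ultimately show ?thesis
      using gen_class_rel[OF that(1)] that(2,3) by metis
  qed
  assume "(u, v) \<in> braid_rels n"
  then consider
      (braid) i where "i \<in> {1..n-2}" "u = pos_word [i, i+1, i]" "v = pos_word [i+1, i, i+1]"
    | (comm) i j where "i \<in> {1..n-1}" "j \<in> {1..n-1}" "\<bar>int i - int j\<bar> \<ge> 2"
        "u = pos_word [i, j]" "v = pos_word [j, i]"
    unfolding braid_rels_def by blast
  then show "word_eval (vbraid_group n) (vbraid_sigma n) u =
      word_eval (vbraid_group n) (vbraid_sigma n) v"
  proof cases
    case braid
    have "(pos_word (map VSigma [i, i+1, i]), pos_word (map VSigma [i+1, i, i+1])) \<in> vbraid_rels n"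
      using braid(1) by (simp add: vbraid_rels_def)
    moreover have "set [i, i+1, i] \<subseteq> {1..n-1}" "set [i+1, i, i+1] \<subseteq> {1..n-1}"
      using braid(1) by auto
    ultimately show ?thesis
      unfolding braid(2,3) by (rule *)
  next
    case comm
    then show ?thesis
      using *[of "[i, j]" "[j, i]"] by (auto simp: vbraid_rels_def)
  qed
qed

lemma group_hom_braid_to_vbraid: "group_hom (braid_group n) (vbraid_group n) (braid_to_vbraid n)"
  using group.pres_hom[OF group_vbraid_group braid_to_vbraid_wf] group_braid_group
    group_vbraid_group
  by (simp add: group_hom_def group_hom_axioms_def braid_to_vbraid_def braid_group_def)

lemma braid_to_vbraid_sigma:
  "i \<in> {1..n-1} \<Longrightarrow> braid_to_vbraid n (braid_sigma n i) = vbraid_sigma n i"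
  using group.pres_lift_gen[OF group_vbraid_group braid_to_vbraid_wf]
  by (simp add: braid_to_vbraid_def braid_sigma_def braid_gens_def)

lemma derived_pure_braid_normal: "derived (braid_group n) (pure_braid n) \<lhd> braid_group n"
  unfolding pure_braid_def
  by (intro group.derived_is_normal group_braid_group group_hom.normal_kernel
      group_hom_braid_perm)

lemma derived_pure_vbraid_normal: "derived (vbraid_group n) (pure_vbraid n) \<lhd> vbraid_group n"
  unfolding pure_vbraid_def
  by (intro group.derived_is_normal group_vbraid_group group_hom.normal_kernel
      group_hom_vbraid_perm)

end

theory Submission
  imports Defs "HOL-Algebra.FiniteProduct"
begin

text \<open>
  The natural map \<open>B\<^sub>n \<rightarrow> VB\<^sub>n\<close> sends pure braids to pure virtual braids, hence \<open>\<Gamma>\<^sub>2(P\<^sub>n)\<close> into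
  \<open>\<Gamma>\<^sub>2(VP\<^sub>n)\<close>. By the first isomorphism theorem (\<open>quotient_mon_if_preimage_eq\<close>) the claim is that,
  conversely, a braid whose image lies in \<open>\<Gamma>\<^sub>2(VP\<^sub>n)\<close> lies in \<open>\<Gamma>\<^sub>2(P\<^sub>n)\<close>. Linking numbers show this.
  Counting, with signs, the classical crossings of one strand over another gives a homomorphism
  \<open>vlink n\<close> from \<open>VB\<^sub>n\<close> to a semidirect product of the symmetric group with integer functions on
  pairs of strands. On \<open>VP\<^sub>n\<close> it takes values in an abelian group, so it is trivial on \<open>\<Gamma>\<^sub>2(VP\<^sub>n)\<close>
  (\<open>vlink_derived_pure\<close>). A braid whose image lies in \<open>\<Gamma>\<^sub>2(VP\<^sub>n)\<close> is therefore pure and has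
  vanishing linking numbers, and it remains to see that linking numbers are faithful on
  \<open>P\<^sub>n / \<Gamma>\<^sub>2(P\<^sub>n)\<close> (\<open>linking_numbers_detect_derived\<close>).

  For this, \<open>P\<^sub>n\<close> is generated by the conjugates of \<open>\<sigma>\<^bsub>n-1\<^esub>\<^sup>2\<close> (\<open>pure_braid_eq_twist_subgroup\<close>): modulo
  these the \<open>\<sigma>\<^sub>i\<close> satisfy the Coxeter relations, and a normal form for the Coxeter relations
  (\<open>normal_form\<close>) shows that a word with trivial permutation is then trivial. The same normal form
  describes the braids that preserve the last two positions (\<open>last_pair_stabilizer\<close>), and it follows
  that modulo \<open>\<Gamma>\<^sub>2(P\<^sub>n)\<close> a conjugate \<open>g \<sigma>\<^bsub>n-1\<^esub>\<^sup>2 g\<^sup>-\<^sup>1\<close> depends only on the pair of strands that it links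
  (\<open>band_twist_coset_eq\<close>). So \<open>P\<^sub>n / \<Gamma>\<^sub>2(P\<^sub>n)\<close> is generated by one element for each pair of strands, and
  the linking number of a pair counts exactly the corresponding generator.
\<close>

section \<open>Words in generators\<close>

abbreviation pos_eval :: "('a, 'b) monoid_scheme \<Rightarrow> ('g \<Rightarrow> 'a) \<Rightarrow> 'g list \<Rightarrow> 'a" where
  "pos_eval G f xs \<equiv> word_eval G f (pos_word xs)"

lemma pos_word_in_gen_words: "set xs \<subseteq> X \<Longrightarrow> pos_word xs \<in> gen_words X"
  by (auto simp: gen_words_def)

context group
begin

lemma pos_eval_closed: "f ` set xs \<subseteq> carrier G \<Longrightarrow> pos_eval G f xs \<in> carrier G"
  by (rule word_eval_closed[of f "set xs"]) (auto simp: pos_word_in_gen_words)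

lemma pos_eval_append:
  assumes "f ` set xs \<subseteq> carrier G" "f ` set ys \<subseteq> carrier G"
  shows "pos_eval G f (xs @ ys) = pos_eval G f xs \<otimes> pos_eval G f ys"
  using word_eval_append[of f "set xs \<union> set ys" "pos_word xs" "pos_word ys"] assms
  by (auto simp: pos_word_in_gen_words)

lemma pos_eval_commute:
  assumes "x \<in> carrier G" "f ` set ys \<subseteq> carrier G"
    and "\<And>y. y \<in> set ys \<Longrightarrow> x \<otimes> f y = f y \<otimes> x"
  shows "x \<otimes> pos_eval G f ys = pos_eval G f ys \<otimes> x"
  using assms(2,3)
proof (induction ys)
  case (Cons y ys)
  have c: "f y \<in> carrier G" "pos_eval G f ys \<in> carrier G"
    using Cons.prems by (auto intro: pos_eval_closed)
  have "x \<otimes> (f y \<otimes> pos_eval G f ys) = f y \<otimes> (x \<otimes> pos_eval G f ys)"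
    using c assms(1) Cons.prems(2)[of y] by (simp flip: m_assoc)
  also have "\<dots> = f y \<otimes> pos_eval G f ys \<otimes> x"
    using c assms(1) Cons by (simp add: m_assoc)
  finally show ?case by simp
qed (use assms(1) in simp)

end

lemma (in group_hom) hom_word_eval:
  assumes "f \<in> X \<rightarrow> carrier G" "u \<in> gen_words X"
  shows "h (word_eval G f u) = word_eval H (\<lambda>x. h (f x)) u"
  using assms(2)
proof (induction u)
  case (Cons a u)
  then show ?case
    using assms(1) G.word_eval_closed[OF assms(1)] by (cases a) (auto simp: Pi_iff)
qed simp

lemma (in group_hom) hom_pos_eval:
  assumes "f ` set xs \<subseteq> carrier G"
  shows "h (pos_eval G f xs) = pos_eval H (\<lambda>x. h (f x)) xs"
  using hom_word_eval[of f "set xs" "pos_word xs"] assms by (auto simp: pos_word_in_gen_words)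

text \<open>
  Every class is the value of any of its words in the presented group itself. This is what reduces
  statements about elements to statements about words, and homomorphisms to their values on
  generators (\<open>pres_hom_ext\<close>).
\<close>

lemma pres_class_eq_word_eval:
  assumes "u \<in> gen_words X"
  shows "pres_class X R u = word_eval (pres_group X R) (gen_class X R) u"
proof -
  interpret group "pres_group X R" by (rule group_pres_group)
  show ?thesis using assms
  proof (induction u)
    case Nil
    show ?case by (simp add: pres_group_one)
  next
    case (Cons a u)
    obtain x b where a: "a = (x, b)" by (cases a)
    have x: "x \<in> X" and u: "u \<in> gen_words X" using Cons.prems a by auto
    have inv: "inv\<^bsub>pres_group X R\<^esub> (gen_class X R x) = pres_class X R [(x, False)]"
    proof (rule inv_equality)
      show "pres_class X R [(x, False)] \<otimes>\<^bsub>pres_group X R\<^esub> gen_class X R x = \<one>\<^bsub>pres_group X R\<^esub>"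
        using x pres_class_eq_iff[of "[(x, False), (x, True)]" X R "[]"]
          pres_eq.cancel[OF x, of R False]
        by (simp add: gen_class_def pres_class_mult pres_group_one)
    qed (use x gen_class_closed[OF x] in \<open>auto simp: pres_group_carrier\<close>)
    have "pres_class X R (a # u) = pres_class X R [a] \<otimes>\<^bsub>pres_group X R\<^esub> pres_class X R u"
      using pres_class_mult[of "[a]" X u R] x u a by simp
    then show ?case
      using Cons.IH[OF u] inv a by (simp add: gen_class_def)
  qed
qed

lemma pres_group_elem_word:
  assumes "x \<in> carrier (pres_group X R)"
  obtains u where "u \<in> gen_words X" "x = word_eval (pres_group X R) (gen_class X R) u"
  using assms that by (auto simp: pres_group_carrier pres_class_eq_word_eval)

lemma pres_hom_ext:
  assumes "group_hom (pres_group X R) G f" "group_hom (pres_group X R) G g"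
    and gens: "\<And>x. x \<in> X \<Longrightarrow> f (gen_class X R x) = g (gen_class X R x)"
    and "x \<in> carrier (pres_group X R)"
  shows "f x = g x"
proof -
  obtain u where u: "u \<in> gen_words X" "x = word_eval (pres_group X R) (gen_class X R) u"
    using pres_group_elem_word assms(4) by metis
  have c: "gen_class X R \<in> X \<rightarrow> carrier (pres_group X R)"
    by (auto intro: gen_class_closed)
  have "word_eval G (\<lambda>x. f (gen_class X R x)) u = word_eval G (\<lambda>x. g (gen_class X R x)) u"
    using u(1)
  proof (induction u)
    case (Cons a u)
    then show ?case by (cases a) (auto simp: gens)
  qed simp
  then show ?thesis
    using u group_hom.hom_word_eval[OF assms(1) c] group_hom.hom_word_eval[OF assms(2) c] by simp
qed

section \<open>The Coxeter relations of the symmetric group\<close>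

locale coxeter_relations = group +
  fixes n :: nat and s :: "nat \<Rightarrow> 'a"
  assumes s_closed: "i \<in> {1..<n} \<Longrightarrow> s i \<in> carrier G"
    and s_square: "i \<in> {1..<n} \<Longrightarrow> s i \<otimes> s i = \<one>"
    and s_braid: "i \<in> {1..<n} \<Longrightarrow> i + 1 < n \<Longrightarrow>
      s i \<otimes> (s (i + 1) \<otimes> s i) = s (i + 1) \<otimes> (s i \<otimes> s (i + 1))"
    and s_commute: "i \<in> {1..<n} \<Longrightarrow> j \<in> {1..<n} \<Longrightarrow> i + 2 \<le> j \<Longrightarrow> s i \<otimes> s j = s j \<otimes> s i"
begin

lemma s_img_closed: "set xs \<subseteq> {1..<n} \<Longrightarrow> s ` set xs \<subseteq> carrier G"
  using s_closed by auto

lemma eval_closed: "set xs \<subseteq> {1..<n} \<Longrightarrow> pos_eval G s xs \<in> carrier G"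
  by (intro pos_eval_closed s_img_closed)

lemma eval_append:
  "set xs \<subseteq> {1..<n} \<Longrightarrow> set ys \<subseteq> {1..<n} \<Longrightarrow>
   pos_eval G s (xs @ ys) = pos_eval G s xs \<otimes> pos_eval G s ys"
  by (intro pos_eval_append s_img_closed)

lemma eval_commute:
  assumes i: "i \<in> {1..<n}" and ys: "set ys \<subseteq> {1..<n}"
    and far: "\<And>y. y \<in> set ys \<Longrightarrow> y + 2 \<le> i \<or> i + 2 \<le> y"
  shows "s i \<otimes> pos_eval G s ys = pos_eval G s ys \<otimes> s i"
proof (rule pos_eval_commute)
  fix y assume y: "y \<in> set ys"
  then have "y \<in> {1..<n}" using ys by auto
  then show "s i \<otimes> s y = s y \<otimes> s i"
    using s_commute[of i y] s_commute[of y i] i far[OF y] by auto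
qed (use i ys s_closed in auto)

text \<open>
  In a descending run \<open>s\<^bsub>m-1\<^esub> \<dots> s\<^sub>j\<close>, a letter \<open>i > j\<close> arriving from the right commutes up to the factor
  \<open>s\<^sub>i s\<^bsub>i-1\<^esub>\<close>, turns \<open>s\<^sub>i s\<^bsub>i-1\<^esub> s\<^sub>i\<close> into \<open>s\<^bsub>i-1\<^esub> s\<^sub>i s\<^bsub>i-1\<^esub>\<close>, and leaves on the left as \<open>s\<^bsub>i-1\<^esub>\<close>.
\<close>

lemma descending_shift:
  assumes "1 \<le> j" "j < i" "i < m" "m \<le> n"
  shows "pos_eval G s (rev [j..<m] @ [i]) = pos_eval G s ([i - 1] @ rev [j..<m])"
proof -
  define X where "X = rev [i + 1..<m]"
  define Y where "Y = rev [j..<i - 1]"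
  have "[j..<m] = [j..<i - 1] @ [i - 1, i] @ [i + 1..<m]"
  proof -
    have "[j..<m] = [j..<i - 1] @ [i - 1..<m]"
      using assms upt_add_eq_append[of j "i - 1" "m - (i - 1)"] by simp
    moreover have "[i - 1..<m] = [i - 1, i] @ [i + 1..<m]"
      using assms by (simp add: upt_conv_Cons)
    ultimately show ?thesis by simp
  qed
  then have split: "rev [j..<m] = X @ [i, i - 1] @ Y"
    by (simp add: X_def Y_def)
  have sets: "set X \<subseteq> {1..<n}" "set Y \<subseteq> {1..<n}" "i \<in> {1..<n}" "i - 1 \<in> {1..<n}"
    using assms by (auto simp: X_def Y_def)
  define x y where "x = pos_eval G s X" and "y = pos_eval G s Y"
  have c: "x \<in> carrier G" "y \<in> carrier G" "s i \<in> carrier G" "s (i - 1) \<in> carrier G"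
    unfolding x_def y_def
    using eval_closed[OF sets(1)] eval_closed[OF sets(2)] s_closed[OF sets(3)] s_closed[OF sets(4)]
    by blast+
  have yi: "y \<otimes> s i = s i \<otimes> y"
    unfolding y_def using sets assms by (intro eval_commute[symmetric]) (auto simp: Y_def)
  have xi: "x \<otimes> s (i - 1) = s (i - 1) \<otimes> x"
    unfolding x_def using sets assms by (intro eval_commute[symmetric]) (auto simp: X_def)
  have br: "s i \<otimes> (s (i - 1) \<otimes> s i) = s (i - 1) \<otimes> (s i \<otimes> s (i - 1))"
    using s_braid[OF sets(4)] assms by simp
  have "pos_eval G s (rev [j..<m] @ [i]) = x \<otimes> (s i \<otimes> (s (i - 1) \<otimes> (y \<otimes> s i)))"
    unfolding split using sets c by (simp add: eval_append x_def y_def m_assoc del: map_append)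
  also have "\<dots> = x \<otimes> (s i \<otimes> (s (i - 1) \<otimes> s i) \<otimes> y)"
    unfolding yi using c by (simp add: m_assoc)
  also have "\<dots> = (x \<otimes> s (i - 1)) \<otimes> (s i \<otimes> (s (i - 1) \<otimes> y))"
    unfolding br using c by (simp add: m_assoc)
  also have "\<dots> = pos_eval G s ([i - 1] @ rev [j..<m])"
    unfolding split xi using sets c by (simp add: eval_append x_def y_def m_assoc del: map_append)
  finally show ?thesis .
qed

text \<open>
  The Coxeter relations alone bring every word in the first \<open>m - 1\<close> letters into the shape of a word
  that avoids \<open>s\<^bsub>m-1\<^esub>\<close>, followed by a descending run \<open>s\<^bsub>m-1\<^esub> \<dots> s\<^sub>j\<close>: the runs represent all cosets of the
  subgroup generated by the smaller letters. For permutations of \<open>1, \<dots>, m\<close> the index \<open>j\<close> is read off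
  as the preimage of \<open>m\<close>, so the shape can be analysed by looking at the permutation only.
\<close>

lemma normal_form:
  assumes "set xs \<subseteq> {1..<m}" "1 \<le> m" "m \<le> n"
  shows "\<exists>ys j. set ys \<subseteq> {1..<m - 1} \<and> j \<in> {1..m} \<and>
    pos_eval G s xs = pos_eval G s (ys @ rev [j..<m])"
  using assms(1)
proof (induction xs rule: rev_induct)
  case Nil
  show ?case
    by (rule exI[of _ "[]"], rule exI[of _ m]) (use assms in auto)
next
  case (snoc i xs)
  then obtain ys j where ys: "set ys \<subseteq> {1..<m - 1}" and j: "j \<in> {1..m}"
    and eq: "pos_eval G s xs = pos_eval G s (ys @ rev [j..<m])" by auto
  have i: "1 \<le> i" "i < m" "i \<in> {1..<n}" using snoc.prems assms by auto
  have ysn: "set ys \<subseteq> {1..<n}" and xsn: "set xs \<subseteq> {1..<n}" and jn: "set (rev [j..<m]) \<subseteq> {1..<n}"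
    using ys snoc.prems j assms by fastforce+
  have cy: "pos_eval G s ys \<in> carrier G" and si: "s i \<in> carrier G"
    using eval_closed[OF ysn] s_closed[OF i(3)] by blast+
  have push: "pos_eval G s (xs @ [i]) = pos_eval G s ys \<otimes> pos_eval G s (rev [j..<m] @ [i])"
  proof -
    have "pos_eval G s (xs @ [i]) = pos_eval G s (ys @ rev [j..<m]) \<otimes> pos_eval G s [i]"
      using eval_append[OF xsn, of "[i]"] i by (simp add: eq)
    also have "\<dots> = pos_eval G s ((ys @ rev [j..<m]) @ [i])"
      using ysn jn i by (intro eval_append[symmetric]) auto
    also have "\<dots> = pos_eval G s ys \<otimes> pos_eval G s (rev [j..<m] @ [i])"
      using ysn jn i by (simp only: append_assoc, intro eval_append) auto
    finally show ?thesis .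
  qed
  \<comment> \<open>A new last letter \<open>i\<close> commutes through the run, extends it, cancels its end, or is shifted
    through it.\<close>
  consider "i + 1 < j" | "i + 1 = j" | "i = j" | "j < i" by linarith
  then show ?case
  proof cases
    case 1
    have "pos_eval G s (rev [j..<m] @ [i]) = s i \<otimes> pos_eval G s (rev [j..<m])"
      using eval_append[OF jn, of "[i]"] eval_commute[OF i(3) jn] i 1 si by auto
    then have "pos_eval G s (xs @ [i]) = pos_eval G s ((ys @ [i]) @ rev [j..<m])"
      unfolding push using ysn jn i cy si eval_closed[OF jn]
      by (simp add: eval_append m_assoc del: map_append)
    then show ?thesis
      using ys i 1 j by (intro exI[of _ "ys @ [i]"] exI[of _ j]) auto
  next
    case 2
    then have "rev [j..<m] @ [i] = rev [i..<m]"
      using i by (simp add: upt_conv_Cons)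
    then have "pos_eval G s (xs @ [i]) = pos_eval G s (ys @ rev [i..<m])"
      unfolding push using ysn i assms by (subst eval_append) auto
    then show ?thesis
      using ys i by (intro exI[of _ ys] exI[of _ i]) auto
  next
    case 3
    have tl: "rev [i..<m] = rev [i + 1..<m] @ [i]" using i by (simp add: upt_conv_Cons)
    have cz: "set (rev [i + 1..<m]) \<subseteq> {1..<n}" using assms by auto
    have "pos_eval G s (rev [i + 1..<m] @ [i, i]) = pos_eval G s (rev [i + 1..<m])"
      using cz i si eval_closed[OF cz] s_square by (subst eval_append) auto
    then have "pos_eval G s (rev [j..<m] @ [i]) = pos_eval G s (rev [i + 1..<m])"
      using 3 tl by simp
    then have "pos_eval G s (xs @ [i]) = pos_eval G s (ys @ rev [i + 1..<m])"
      unfolding push using ysn cz by (simp add: eval_append del: map_append)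
    then show ?thesis
      using ys i by (intro exI[of _ ys] exI[of _ "i + 1"]) auto
  next
    case 4
    have i': "set [i - 1] \<subseteq> {1..<n}" using i 4 j by auto
    have "pos_eval G s (xs @ [i]) = pos_eval G s ys \<otimes> pos_eval G s ([i - 1] @ rev [j..<m])"
      unfolding push using descending_shift[of j i m] i 4 j assms by auto
    also have "\<dots> = pos_eval G s (ys @ [i - 1] @ rev [j..<m])"
      using ysn i' jn by (subst eval_append) auto
    finally show ?thesis
      using ys i 4 j by (intro exI[of _ "ys @ [i - 1]"] exI[of _ j]) auto
  qed
qed

end

abbreviation perm_word :: "nat \<Rightarrow> nat list \<Rightarrow> nat \<Rightarrow> nat" where
  "perm_word n \<equiv> pos_eval (sym_group n) (\<lambda>i. transpose i (i + 1))"

lemma perm_word_append: "perm_word n (xs @ ys) = perm_word n xs \<circ> perm_word n ys"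
  by (induction xs) (auto simp: sym_group_mult sym_group_one comp_assoc)

lemma perm_word_fixes:
  assumes "\<And>y. y \<in> set ys \<Longrightarrow> k \<noteq> y \<and> k \<noteq> y + 1"
  shows "perm_word n ys k = k"
  using assms by (induction ys) (auto simp: sym_group_mult sym_group_one transpose_def)

lemma perm_word_descending: "j \<le> m \<Longrightarrow> perm_word n (rev [j..<m]) j = m"
proof (induction m)
  case (Suc m)
  then show ?case
    by (cases "j = Suc m") (auto simp: sym_group_mult sym_group_one transpose_def)
qed (auto simp: sym_group_mult sym_group_one)

section \<open>Virtual linking numbers\<close>

text \<open>
  The semidirect product of \<open>sym_group n\<close> with the integer functions on pairs of strands. The
  functions are acted on from the right, by precomposition, so that no inverse permutation occurs.
\<close>

definition link_group :: "nat \<Rightarrow> ((nat \<Rightarrow> nat \<Rightarrow> int) \<times> (nat \<Rightarrow> nat)) monoid" where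
  "link_group n =
     \<lparr> carrier = UNIV \<times> {p. p permutes {1..n}},
       mult = (\<lambda>(v, p) (w, q). (\<lambda>a b. v (q a) (q b) + w a b, p \<circ> q)),
       one = (\<lambda>a b. 0, id) \<rparr>"

lemma link_group_carrier: "x \<in> carrier (link_group n) \<longleftrightarrow> snd x permutes {1..n}"
  by (cases x) (simp add: link_group_def)

lemma link_group_mult:
  "x \<otimes>\<^bsub>link_group n\<^esub> y =
   (\<lambda>a b. fst x (snd y a) (snd y b) + fst y a b, snd x \<circ> snd y)"
  by (cases x, cases y) (simp add: link_group_def)

lemma link_group_one: "\<one>\<^bsub>link_group n\<^esub> = (\<lambda>a b. 0, id)"
  by (simp add: link_group_def)

lemma group_link_group: "group (link_group n)"
proof (rule groupI)
  fix x assume x: "x \<in> carrier (link_group n)"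
  define q where "q = inv_into UNIV (snd x)"
  have q: "q permutes {1..n}" "q \<circ> snd x = id"
    using x by (auto simp: q_def link_group_carrier permutes_inv permutes_inv_o)
  have qq: "q (snd x a) = a" for a using q(2) by (metis comp_apply id_apply)
  show "\<exists>y \<in> carrier (link_group n). y \<otimes>\<^bsub>link_group n\<^esub> x = \<one>\<^bsub>link_group n\<^esub>"
    using q qq
    by (intro bexI[of _ "(\<lambda>a b. - fst x (q a) (q b), q)"])
      (auto simp: link_group_carrier link_group_mult link_group_one)
qed (auto simp: link_group_carrier link_group_mult link_group_one permutes_id permutes_compose
    comp_assoc prod_eq_iff fun_eq_iff)

lemma link_group_snd_hom: "group_hom (link_group n) (sym_group n) snd"
  using group_link_group sym_group_is_group
  by (auto simp: group_hom_def group_hom_axioms_def hom_def link_group_carrier link_group_mult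
      sym_group_carrier sym_group_mult)

text \<open>
  A classical crossing counts as one crossing of the ordered pair of strands at positions \<open>i\<close> and
  \<open>i + 1\<close>; a virtual crossing only permutes. The extension to the virtual braid group records for
  each ordered pair of strands the signed number of classical crossings of the first over the second.
\<close>

definition vlink_gen :: "vgen \<Rightarrow> (nat \<Rightarrow> nat \<Rightarrow> int) \<times> (nat \<Rightarrow> nat)" where
  "vlink_gen = case_vgen
     (\<lambda>i. (\<lambda>a b. of_bool (a = i \<and> b = i + 1), transpose i (i + 1)))
     (\<lambda>i. (\<lambda>a b. 0, transpose i (i + 1)))"

definition vlink :: "nat \<Rightarrow> vgen word set \<Rightarrow> (nat \<Rightarrow> nat \<Rightarrow> int) \<times> (nat \<Rightarrow> nat)" where
  "vlink n = pres_lift (link_group n) vlink_gen"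

lemma vlink_wf:
  "vlink_gen \<in> vbraid_gens n \<rightarrow> carrier (link_group n)"
  "(u, v) \<in> vbraid_rels n \<Longrightarrow>
     word_eval (link_group n) vlink_gen u = word_eval (link_group n) vlink_gen v"
proof -
  show "vlink_gen \<in> vbraid_gens n \<rightarrow> carrier (link_group n)"
    using transpose_in_sym_group
    by (fastforce simp: vbraid_gens_def vlink_gen_def link_group_carrier sym_group_carrier)
  assume "(u, v) \<in> vbraid_rels n"
  then show "word_eval (link_group n) vlink_gen u = word_eval (link_group n) vlink_gen v"
    by (auto simp: vbraid_rels_def vlink_gen_def link_group_mult link_group_one fun_eq_iff
        transpose_def)
qed

lemma group_hom_vlink: "group_hom (vbraid_group n) (link_group n) (vlink n)"
  using group.pres_hom[OF group_link_group vlink_wf] group_vbraid_group group_link_group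
  by (simp add: group_hom_def group_hom_axioms_def vlink_def vbraid_group_def)

lemma vlink_gens:
  assumes "i \<in> {1..n-1}"
  shows "vlink n (vbraid_sigma n i) =
           (\<lambda>a b. of_bool (a = i \<and> b = i + 1), transpose i (i + 1))"
    and "vlink n (vbraid_rho n i) = (\<lambda>a b. 0, transpose i (i + 1))"
  using group.pres_lift_gen[OF group_link_group vlink_wf] assms
  by (simp_all add: vlink_def vbraid_sigma_def vbraid_rho_def vbraid_gens_def vlink_gen_def)

lemma group_hom_comp:
  assumes "group_hom G H f" "group_hom H K g"
  shows "group_hom G K (\<lambda>x. g (f x))"
  using assms by (auto simp: group_hom_def group_hom_axioms_def hom_def)

lemma snd_vlink:
  assumes "x \<in> carrier (vbraid_group n)"
  shows "snd (vlink n x) = vbraid_perm n x"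
proof -
  have "group_hom (vbraid_group n) (sym_group n) (\<lambda>x. snd (vlink n x))"
    by (rule group_hom_comp[OF group_hom_vlink link_group_snd_hom])
  moreover have "snd (vlink n (gen_class (vbraid_gens n) (vbraid_rels n) g)) =
      vbraid_perm n (gen_class (vbraid_gens n) (vbraid_rels n) g)" if "g \<in> vbraid_gens n" for g
    using that vlink_gens[of _ n] vbraid_perm_gens[of _ n]
    unfolding vbraid_gens_def vbraid_sigma_def vbraid_rho_def
    by (elim UnE imageE) (simp_all only: snd_conv)
  ultimately show ?thesis
    using pres_hom_ext group_hom_vbraid_perm[of n] assms unfolding vbraid_group_def by blast
qed

text \<open>
  On pure virtual braids the permutation part is trivial, so the values of \<open>vlink n\<close> there form an
  abelian group of integer functions.
\<close>

lemma vlink_derived_pure: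
  assumes "x \<in> derived (vbraid_group n) (pure_vbraid n)"
  shows "vlink n x = \<one>\<^bsub>link_group n\<^esub>"
proof -
  let ?V = "vbraid_group n" and ?L = "link_group n"
  interpret group_hom ?V ?L "vlink n" by (rule group_hom_vlink)
  have "derived_set ?V (pure_vbraid n) \<subseteq> kernel ?V ?L (vlink n)"
  proof
    fix x assume "x \<in> derived_set ?V (pure_vbraid n)"
    then obtain g h where gh: "g \<in> pure_vbraid n" "h \<in> pure_vbraid n"
      and x: "x = g \<otimes>\<^bsub>?V\<^esub> h \<otimes>\<^bsub>?V\<^esub> inv\<^bsub>?V\<^esub> g \<otimes>\<^bsub>?V\<^esub> inv\<^bsub>?V\<^esub> h" by auto
    have c: "g \<in> carrier ?V" "h \<in> carrier ?V" and p: "snd (vlink n g) = id" "snd (vlink n h) = id"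
      using gh by (auto simp: pure_vbraid_def kernel_def sym_group_one snd_vlink)
    have comm: "vlink n g \<otimes>\<^bsub>?L\<^esub> vlink n h = vlink n h \<otimes>\<^bsub>?L\<^esub> vlink n g"
      using p by (simp add: link_group_mult fun_eq_iff)
    have "vlink n x =
        vlink n h \<otimes>\<^bsub>?L\<^esub> vlink n g \<otimes>\<^bsub>?L\<^esub> inv\<^bsub>?L\<^esub> vlink n g \<otimes>\<^bsub>?L\<^esub> inv\<^bsub>?L\<^esub> vlink n h"
      using c x by (simp add: comm)
    also have "\<dots> = \<one>\<^bsub>?L\<^esub>"
      using c by (simp add: H.m_assoc H.r_inv_ex)
    finally show "x \<in> kernel ?V ?L (vlink n)"
      using c x by (simp add: kernel_def)
  qed
  then have "derived ?V (pure_vbraid n) \<subseteq> kernel ?V ?L (vlink n)"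
    unfolding derived_def by (rule G.generate_subgroup_incl[OF _ subgroup_kernel])
  then show ?thesis using assms by (auto simp: kernel_def)
qed

section \<open>Detecting trivial elements by coordinates\<close>

text \<open>
  A generating family \<open>t\<close> of \<open>K\<close>, labelled by \<open>p\<close>, has additive coordinates \<open>e\<close> that take the value
  1 at the label and 0 elsewhere. If the image of a generator in an abelian group depends on
  its label only, then \<open>F x\<close> is the product, over all labels, of these images raised to the
  coordinates of \<open>x\<close>, since both sides are homomorphisms that agree on the generators. In
  particular \<open>F\<close> cannot see anything beyond the coordinates.
\<close>

lemma hom_eq_one_if_coordinates_zero:
  fixes e :: "'a \<Rightarrow> 'j \<Rightarrow> int" and t :: "'i \<Rightarrow> 'a" and p :: "'i \<Rightarrow> 'j"
  assumes hom: "group_hom K A F" and comm: "comm_group A"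
    and t: "t ` I \<subseteq> carrier K" and gen: "carrier K = generate K (t ` I)"
    and add: "\<And>x y j. x \<in> carrier K \<Longrightarrow> y \<in> carrier K \<Longrightarrow> e (x \<otimes>\<^bsub>K\<^esub> y) j = e x j + e y j"
    and fin: "finite (p ` I)"
    and coord: "\<And>i j. i \<in> I \<Longrightarrow> j \<in> p ` I \<Longrightarrow> e (t i) j = of_bool (j = p i)"
    and F: "\<And>i i'. i \<in> I \<Longrightarrow> i' \<in> I \<Longrightarrow> p i = p i' \<Longrightarrow> F (t i) = F (t i')"
    and x: "x \<in> carrier K" and zero: "\<And>j. j \<in> p ` I \<Longrightarrow> e x j = 0"
  shows "F x = \<one>\<^bsub>A\<^esub>"
proof -
  interpret F: group_hom K A F by (rule hom)
  interpret A: comm_group A by (rule comm)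
  \<comment> \<open>The common image of the generators with label \<open>j\<close>.\<close>
  define c where "c = (\<lambda>j. F (t (SOME i. i \<in> I \<and> p i = j)))"
  have c: "c (p i) = F (t i)" if "i \<in> I" for i
    unfolding c_def using someI[of "\<lambda>i'. i' \<in> I \<and> p i' = p i" i] that by (auto intro: F)
  have c_closed: "c j \<in> carrier A" if "j \<in> p ` I" for j
    using that c t by auto
  define \<Psi> where "\<Psi> = (\<lambda>x. finprod A (\<lambda>j. c j [^]\<^bsub>A\<^esub> e x j) (p ` I))"
  have "\<Psi> \<in> hom K A"
  proof (rule homI)
    fix x assume "x \<in> carrier K"
    show "\<Psi> x \<in> carrier A"
      unfolding \<Psi>_def by (rule A.finprod_closed) (use c_closed in auto)
  next
    fix x y assume "x \<in> carrier K" "y \<in> carrier K"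
    then have "\<Psi> (x \<otimes>\<^bsub>K\<^esub> y) =
        finprod A (\<lambda>j. c j [^]\<^bsub>A\<^esub> e x j \<otimes>\<^bsub>A\<^esub> c j [^]\<^bsub>A\<^esub> e y j) (p ` I)"
      unfolding \<Psi>_def using c_closed
      by (intro A.finprod_cong') (auto simp: add F.H.int_pow_mult)
    also have "\<dots> = \<Psi> x \<otimes>\<^bsub>A\<^esub> \<Psi> y"
      unfolding \<Psi>_def by (rule A.finprod_multf) (use c_closed in auto)
    finally show "\<Psi> (x \<otimes>\<^bsub>K\<^esub> y) = \<Psi> x \<otimes>\<^bsub>A\<^esub> \<Psi> y" .
  qed
  then interpret \<Psi>: group_hom K A \<Psi>
    by unfold_locales
  have on_gens: "F h = \<Psi> h" if "h \<in> t ` I" for h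
  proof -
    obtain i where i: "i \<in> I" "h = t i" using \<open>h \<in> t ` I\<close> by auto
    have "\<Psi> h = finprod A (\<lambda>j. if p i = j then c j else \<one>\<^bsub>A\<^esub>) (p ` I)"
      unfolding \<Psi>_def using i c_closed by (intro A.finprod_cong') (auto simp: coord)
    also have "\<dots> = c (p i)"
      by (rule A.finprod_singleton) (use i fin c_closed in auto)
    finally show ?thesis using c i by simp
  qed
  have "x \<in> generate K (t ` I)" using x gen by simp
  then have "F x = \<Psi> x"
  proof (induction rule: generate.induct)
    case (inv h)
    then have "h \<in> carrier K" using t by auto
    then show ?case using on_gens[OF inv] by simp
  next
    case (eng g h)
    then show ?case using gen by simp
  qed (auto simp: on_gens)
  also have "\<Psi> x = \<one>\<^bsub>A\<^esub>"
    unfolding \<Psi>_def by (rule A.finprod_one_eqI) (simp add: zero)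
  finally show ?thesis .
qed

section \<open>Generators of the pure braid group\<close>

lemma (in group) cosets_eqE:
  assumes "subgroup N G" "x \<in> carrier G" "y \<in> carrier G" "N #> x = N #> y"
  obtains h where "h \<in> N" "x = h \<otimes> y"
  using assms rcos_self[of x N] by (auto simp: r_coset_def)

lemma (in normal) conj_closed: "h \<in> H \<Longrightarrow> g \<in> carrier G \<Longrightarrow> g \<otimes> h \<otimes> inv g \<in> H"
  using inv_op_closed2 by blast

lemma (in group) conj_conj:
  assumes "g \<in> carrier G" "h \<in> carrier G" "x \<in> carrier G"
  shows "g \<otimes> (h \<otimes> x \<otimes> inv h) \<otimes> inv g = (g \<otimes> h) \<otimes> x \<otimes> inv (g \<otimes> h)"
  using assms by (simp add: inv_mult_group m_assoc)

lemma (in group) conj_square: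
  assumes "g \<in> carrier G" "x \<in> carrier G"
  shows "g \<otimes> (x \<otimes> x) \<otimes> inv g = (g \<otimes> x \<otimes> inv g) \<otimes> (g \<otimes> x \<otimes> inv g)"
  using assms by (simp add: m_assoc inv_solve_left)

lemma braid_sigma_closed: "i \<in> {1..<n} \<Longrightarrow> braid_sigma n i \<in> carrier (braid_group n)"
  unfolding braid_sigma_def braid_group_def by (rule gen_class_closed) (auto simp: braid_gens_def)

lemma braid_sigma_braid:
  assumes "i \<in> {1..<n}" "i + 1 < n"
  shows "braid_sigma n i \<otimes>\<^bsub>braid_group n\<^esub> (braid_sigma n (i + 1) \<otimes>\<^bsub>braid_group n\<^esub> braid_sigma n i) =
    braid_sigma n (i + 1) \<otimes>\<^bsub>braid_group n\<^esub> (braid_sigma n i \<otimes>\<^bsub>braid_group n\<^esub> braid_sigma n (i + 1))"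
proof -
  interpret group "braid_group n" by (rule group_braid_group)
  have "pos_eval (braid_group n) (braid_sigma n) [i, i + 1, i] =
      pos_eval (braid_group n) (braid_sigma n) [i + 1, i, i + 1]"
    unfolding braid_group_def braid_sigma_def[abs_def]
    by (rule gen_class_rel) (use assms in \<open>auto simp: braid_rels_def braid_gens_def\<close>)
  then show ?thesis
    using assms braid_sigma_closed[of i n] braid_sigma_closed[of "i + 1" n] by simp
qed

lemma braid_sigma_commute:
  assumes "i \<in> {1..<n}" "j \<in> {1..<n}" "i + 2 \<le> j"
  shows "braid_sigma n i \<otimes>\<^bsub>braid_group n\<^esub> braid_sigma n j =
    braid_sigma n j \<otimes>\<^bsub>braid_group n\<^esub> braid_sigma n i"
proof -
  interpret group "braid_group n" by (rule group_braid_group)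
  have "pos_eval (braid_group n) (braid_sigma n) [i, j] =
      pos_eval (braid_group n) (braid_sigma n) [j, i]"
    unfolding braid_group_def braid_sigma_def[abs_def]
    by (rule gen_class_rel) (use assms in \<open>auto simp: braid_rels_def braid_gens_def\<close>)
  then show ?thesis
    using assms braid_sigma_closed[of i n] braid_sigma_closed[of j n] by simp
qed

text \<open>
  The conjugates of \<open>\<sigma>\<^bsub>n-1\<^esub>\<^sup>2\<close>, in which two strands make a full twist around each other: the usual
  generators \<open>A\<^sub>i\<^sub>j\<close> of the pure braid group are among them. Allowing all conjugators avoids a choice of
  paths along which the strands are brought together.
\<close>

definition band_twist :: "nat \<Rightarrow> nat word set \<Rightarrow> nat word set" where
  "band_twist n g = g \<otimes>\<^bsub>braid_group n\<^esub>
     (braid_sigma n (n - 1) \<otimes>\<^bsub>braid_group n\<^esub> braid_sigma n (n - 1)) \<otimes>\<^bsub>braid_group n\<^esub>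
     inv\<^bsub>braid_group n\<^esub> g"

definition twist_subgroup :: "nat \<Rightarrow> nat word set set" where
  "twist_subgroup n = generate (braid_group n) (band_twist n ` carrier (braid_group n))"

lemma braid_perm_pos_eval:
  assumes "set xs \<subseteq> {1..<n}"
  shows "braid_perm n (pos_eval (braid_group n) (braid_sigma n) xs) = perm_word n xs"
proof -
  interpret group_hom "braid_group n" "sym_group n" "braid_perm n"
    by (rule group_hom_braid_perm)
  have "braid_perm n (pos_eval (braid_group n) (braid_sigma n) xs) =
      pos_eval (sym_group n) (\<lambda>i. braid_perm n (braid_sigma n i)) xs"
    by (rule hom_pos_eval) (use assms braid_sigma_closed in auto)
  also have "\<dots> = perm_word n xs"
    using assms by (induction xs) (auto simp: braid_perm_sigma)
  finally show ?thesis .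
qed

context
  fixes n :: nat
  assumes n: "n \<ge> 2"
begin

interpretation B: group "braid_group n" by (rule group_braid_group)
interpretation perm: group_hom "braid_group n" "sym_group n" "braid_perm n"
  by (rule group_hom_braid_perm)

private abbreviation (input) bmult (infixl "\<cdot>" 70) where "x \<cdot> y \<equiv> x \<otimes>\<^bsub>braid_group n\<^esub> y"
private abbreviation (input) \<sigma> where "\<sigma> \<equiv> braid_sigma n"
private abbreviation (input) \<pi> where "\<pi> \<equiv> braid_perm n"
private abbreviation (input) M where "M \<equiv> twist_subgroup n"
private abbreviation (input) P where "P \<equiv> pure_braid n"

lemma sigma_last_closed: "\<sigma> (n - 1) \<in> carrier (braid_group n)"
  by (rule braid_sigma_closed) (use n in auto)

lemma band_twist_closed: "g \<in> carrier (braid_group n) \<Longrightarrow> band_twist n g \<in> carrier (braid_group n)"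
  using sigma_last_closed by (simp add: band_twist_def)

lemma pure_braid_normal: "P \<lhd> braid_group n"
  unfolding pure_braid_def by (rule perm.normal_kernel)

lemma band_twist_pure: "g \<in> carrier (braid_group n) \<Longrightarrow> band_twist n g \<in> P"
proof -
  assume g: "g \<in> carrier (braid_group n)"
  have s: "\<sigma> (n - 1) \<in> carrier (braid_group n)" using n by (auto intro: braid_sigma_closed)
  have "\<pi> (\<sigma> (n - 1) \<cdot> \<sigma> (n - 1)) = id"
    using s n braid_perm_sigma[of "n - 1" n] by (simp add: sym_group_mult)
  then have "\<sigma> (n - 1) \<cdot> \<sigma> (n - 1) \<in> P"
    using s by (simp add: pure_braid_def kernel_def sym_group_one)
  then show ?thesis
    unfolding band_twist_def using normal.conj_closed[OF pure_braid_normal] g by blast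
qed

lemma twist_subgroup_normal: "M \<lhd> braid_group n"
  unfolding twist_subgroup_def
proof (rule B.normal_generateI)
  fix h g assume h: "h \<in> band_twist n ` carrier (braid_group n)" and g: "g \<in> carrier (braid_group n)"
  obtain k where k: "k \<in> carrier (braid_group n)" "h = band_twist n k" using h by auto
  have "g \<cdot> h \<cdot> inv\<^bsub>braid_group n\<^esub> g = band_twist n (g \<cdot> k)"
    unfolding k band_twist_def using k(1) g sigma_last_closed by (intro B.conj_conj) auto
  then show "g \<cdot> h \<cdot> inv\<^bsub>braid_group n\<^esub> g \<in> band_twist n ` carrier (braid_group n)"
    using g k by auto
qed (use band_twist_closed in auto)

lemma twist_subgroup_pure: "M \<subseteq> P"
  unfolding twist_subgroup_def
  by (rule B.generate_subgroup_incl)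
    (use band_twist_pure pure_braid_normal normal_imp_subgroup in auto)

text \<open>
  All \<open>\<sigma>\<^sub>i\<close> are conjugate to each other by the braid relations, so the squares of all of them lie in
  the subgroup generated by the conjugates of one square.
\<close>

lemma braid_sigma_conjugate_last:
  assumes "i \<in> {1..<n}"
  shows "\<exists>g \<in> carrier (braid_group n). \<sigma> i = g \<cdot> \<sigma> (n - 1) \<cdot> inv\<^bsub>braid_group n\<^esub> g"
proof -
  have "\<exists>g \<in> carrier (braid_group n). \<sigma> (n - 1 - k) = g \<cdot> \<sigma> (n - 1) \<cdot> inv\<^bsub>braid_group n\<^esub> g"
    if "k < n - 1" for k
    using that
  proof (induction k)
    case 0
    then show ?case
      using n braid_sigma_closed[of "n - 1" n] by (intro bexI[of _ "\<one>\<^bsub>braid_group n\<^esub>"]) auto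
  next
    case (Suc k)
    define j where "j = n - 1 - Suc k"
    have j: "n - 1 - k = j + 1" "j \<in> {1..<n}" "j + 1 < n" using Suc.prems by (auto simp: j_def)
    obtain g where g: "g \<in> carrier (braid_group n)"
      "\<sigma> (j + 1) = g \<cdot> \<sigma> (n - 1) \<cdot> inv\<^bsub>braid_group n\<^esub> g"
      using Suc j by auto
    have c: "\<sigma> j \<in> carrier (braid_group n)" "\<sigma> (j + 1) \<in> carrier (braid_group n)"
      "\<sigma> (n - 1) \<in> carrier (braid_group n)"
      using j by (auto intro!: braid_sigma_closed)
    \<comment> \<open>The braid relation says that \<open>\<sigma>\<^sub>j\<^sub>+\<^sub>1 \<sigma>\<^sub>j\<close> conjugates \<open>\<sigma>\<^sub>j\<^sub>+\<^sub>1\<close> into \<open>\<sigma>\<^sub>j\<close>.\<close>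
    have "\<sigma> j \<cdot> (\<sigma> (j + 1) \<cdot> \<sigma> j) = (\<sigma> (j + 1) \<cdot> \<sigma> j) \<cdot> \<sigma> (j + 1)"
      using braid_sigma_braid[OF j(2,3)] c by (simp add: B.m_assoc)
    then have "\<sigma> j = (\<sigma> (j + 1) \<cdot> \<sigma> j) \<cdot> \<sigma> (j + 1) \<cdot> inv\<^bsub>braid_group n\<^esub> (\<sigma> (j + 1) \<cdot> \<sigma> j)"
      using c by (metis B.inv_solve_right B.m_closed)
    also have "\<dots> = (\<sigma> (j + 1) \<cdot> \<sigma> j) \<cdot> (g \<cdot> \<sigma> (n - 1) \<cdot> inv\<^bsub>braid_group n\<^esub> g) \<cdot>
        inv\<^bsub>braid_group n\<^esub> (\<sigma> (j + 1) \<cdot> \<sigma> j)"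
      using g(2) by simp
    also have "\<dots> = ((\<sigma> (j + 1) \<cdot> \<sigma> j) \<cdot> g) \<cdot> \<sigma> (n - 1) \<cdot>
        inv\<^bsub>braid_group n\<^esub> ((\<sigma> (j + 1) \<cdot> \<sigma> j) \<cdot> g)"
      using c g(1) by (intro B.conj_conj) auto
    finally show ?case
      using c g(1) unfolding j_def by blast
  qed
  from this[of "n - 1 - i"] show ?thesis using assms by auto
qed

lemma braid_sigma_square: "i \<in> {1..<n} \<Longrightarrow> \<sigma> i \<cdot> \<sigma> i \<in> M"
proof -
  assume "i \<in> {1..<n}"
  then obtain g where g: "g \<in> carrier (braid_group n)"
    "\<sigma> i = g \<cdot> \<sigma> (n - 1) \<cdot> inv\<^bsub>braid_group n\<^esub> g"
    using braid_sigma_conjugate_last by blast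
  have "\<sigma> i \<cdot> \<sigma> i = band_twist n g"
    unfolding band_twist_def
    using B.conj_square[OF g(1), of "\<sigma> (n - 1)"] g(2) n braid_sigma_closed[of "n - 1" n] by auto
  then show ?thesis using g(1) by (auto simp: twist_subgroup_def intro: generate.incl)
qed

interpretation M: normal M "braid_group n" by (rule twist_subgroup_normal)

private abbreviation (input) q where "q \<equiv> \<lambda>x. M #>\<^bsub>braid_group n\<^esub> x"

interpretation q: group_hom "braid_group n" "braid_group n Mod M" q
  using M.factorgroup_is_group M.r_coset_hom_Mod B.group_axioms
  by (simp add: group_hom_def group_hom_axioms_def)

text \<open>
  Modulo full twists the braid generators become involutions, and the braid relations become the
  Coxeter relations.
\<close>

interpretation C: coxeter_relations "braid_group n Mod M" n "\<lambda>i. q (\<sigma> i)"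
proof
  fix i assume i: "i \<in> {1..<n}"
  note c = braid_sigma_closed[OF i]
  show "q (\<sigma> i) \<in> carrier (braid_group n Mod M)" using c by (rule q.hom_closed)
  show "q (\<sigma> i) \<otimes>\<^bsub>braid_group n Mod M\<^esub> q (\<sigma> i) = \<one>\<^bsub>braid_group n Mod M\<^esub>"
    using q.hom_mult[OF c c] B.coset_join2[OF _ M.subgroup_axioms braid_sigma_square[OF i]] c by simp
  { assume j: "i + 1 < n"
    have d: "\<sigma> (i + 1) \<in> carrier (braid_group n)" using j by (auto intro: braid_sigma_closed)
    show "q (\<sigma> i) \<otimes>\<^bsub>braid_group n Mod M\<^esub> (q (\<sigma> (i + 1)) \<otimes>\<^bsub>braid_group n Mod M\<^esub> q (\<sigma> i)) =
        q (\<sigma> (i + 1)) \<otimes>\<^bsub>braid_group n Mod M\<^esub> (q (\<sigma> i) \<otimes>\<^bsub>braid_group n Mod M\<^esub> q (\<sigma> (i + 1)))"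
      using braid_sigma_braid[OF i j] c d by (simp flip: q.hom_mult del: mult_FactGroup) }
  { fix j assume j: "j \<in> {1..<n}" "i + 2 \<le> j"
    show "q (\<sigma> i) \<otimes>\<^bsub>braid_group n Mod M\<^esub> q (\<sigma> j) = q (\<sigma> j) \<otimes>\<^bsub>braid_group n Mod M\<^esub> q (\<sigma> i)"
      using braid_sigma_commute[OF i j] c braid_sigma_closed[OF j(1)]
      by (simp flip: q.hom_mult del: mult_FactGroup) }
qed

lemma coset_pos_eval:
  "set xs \<subseteq> {1..<n} \<Longrightarrow>
   q (pos_eval (braid_group n) \<sigma> xs) = pos_eval (braid_group n Mod M) (\<lambda>i. q (\<sigma> i)) xs"
  by (rule q.hom_pos_eval) (use braid_sigma_closed in auto)

lemma pos_eval_sigma_closed: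
  "set xs \<subseteq> {1..<n} \<Longrightarrow> pos_eval (braid_group n) \<sigma> xs \<in> carrier (braid_group n)"
  by (rule B.pos_eval_closed) (use braid_sigma_closed in auto)

lemma perm_eq_of_coset_eq:
  assumes "x \<in> carrier (braid_group n)" "y \<in> carrier (braid_group n)" "q x = q y"
  shows "\<pi> x = \<pi> y"
proof -
  obtain h where h: "h \<in> M" "x = h \<cdot> y"
    using B.cosets_eqE[OF M.subgroup_axioms assms] by blast
  then have "\<pi> h = id" "h \<in> carrier (braid_group n)"
    using twist_subgroup_pure by (auto simp: pure_braid_def kernel_def sym_group_one)
  then show ?thesis using h assms(2) by (simp add: sym_group_mult)
qed

text \<open>
  Cosets of full twists determine permutations, so the normal form in the quotient is at the same
  time one for the permutation of the word.
\<close>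

lemma sigma_normal_form:
  assumes "set xs \<subseteq> {1..<m}" "1 \<le> m" "m \<le> n"
  obtains ys j where "set ys \<subseteq> {1..<m - 1}" "j \<in> {1..m}"
    "q (pos_eval (braid_group n) \<sigma> xs) = q (pos_eval (braid_group n) \<sigma> (ys @ rev [j..<m]))"
    "perm_word n xs = perm_word n (ys @ rev [j..<m])"
proof -
  obtain ys j where ys: "set ys \<subseteq> {1..<m - 1}" "j \<in> {1..m}"
    and eq: "pos_eval (braid_group n Mod M) (\<lambda>i. q (\<sigma> i)) xs =
      pos_eval (braid_group n Mod M) (\<lambda>i. q (\<sigma> i)) (ys @ rev [j..<m])"
    using C.normal_form[OF assms] by blast
  have s: "set xs \<subseteq> {1..<n}" "set (ys @ rev [j..<m]) \<subseteq> {1..<n}"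
    using assms ys by fastforce+
  have eq': "q (pos_eval (braid_group n) \<sigma> xs) = q (pos_eval (braid_group n) \<sigma> (ys @ rev [j..<m]))"
    using eq coset_pos_eval[OF s(1)] coset_pos_eval[OF s(2)] by simp
  then have "perm_word n xs = perm_word n (ys @ rev [j..<m])"
    using perm_eq_of_coset_eq[OF pos_eval_sigma_closed[OF s(1)] pos_eval_sigma_closed[OF s(2)]]
    by (simp only: braid_perm_pos_eval[OF s(1)] braid_perm_pos_eval[OF s(2)])
  then show ?thesis using that ys eq' by blast
qed

text \<open>
  Modulo full twists \<open>\<sigma>\<^sub>i\<close> and its inverse coincide, so the signs in a braid word can be forgotten.
\<close>

lemma braid_coset_positive:
  assumes "x \<in> carrier (braid_group n)"
  obtains xs where "set xs \<subseteq> {1..<n}" "q x = q (pos_eval (braid_group n) \<sigma> xs)"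
    "\<pi> x = perm_word n xs"
proof -
  obtain u where u: "u \<in> gen_words (braid_gens n)" "x = word_eval (braid_group n) \<sigma> u"
    using pres_group_elem_word assms unfolding braid_group_def braid_sigma_def[abs_def] by metis
  have gens: "braid_gens n = {1..<n}" using n by (auto simp: braid_gens_def)
  have s: "set (map fst u) \<subseteq> {1..<n}" using u gens by (auto simp: gen_words_def)
  have "q x = word_eval (braid_group n Mod M) (\<lambda>i. q (\<sigma> i)) u"
    unfolding u(2) using u(1) by (intro q.hom_word_eval) (auto simp: gens braid_sigma_closed)
  also have "\<dots> = pos_eval (braid_group n Mod M) (\<lambda>i. q (\<sigma> i)) (map fst u)"
    using s
  proof (induction u)
    case (Cons a u)
    obtain i b where a: "a = (i, b)" by (cases a)
    have i: "i \<in> {1..<n}" using Cons.prems a by auto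
    have "inv\<^bsub>braid_group n Mod M\<^esub> (q (\<sigma> i)) = q (\<sigma> i)"
      using q.H.inv_equality[OF C.s_square[OF i] C.s_closed[OF i] C.s_closed[OF i]] .
    then show ?case using Cons a by (simp del: mult_FactGroup)
  qed simp
  also have "\<dots> = q (pos_eval (braid_group n) \<sigma> (map fst u))"
    using s by (rule coset_pos_eval[symmetric])
  finally have eq: "q x = q (pos_eval (braid_group n) \<sigma> (map fst u))" .
  then have "\<pi> x = perm_word n (map fst u)"
    using perm_eq_of_coset_eq[OF assms pos_eval_sigma_closed[OF s]] braid_perm_pos_eval[OF s] by simp
  then show ?thesis using that s eq by blast
qed

text \<open>
  The Coxeter relations present the symmetric group: the permutation of a normal form sends \<open>j\<close> to the
  top index, so for the identity permutation the descending run is empty, and the remaining word uses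
  fewer letters.
\<close>

lemma pure_word_in_twist_subgroup:
  assumes "set xs \<subseteq> {1..<m}" "1 \<le> m" "m \<le> n" "perm_word n xs = id"
  shows "pos_eval (braid_group n) \<sigma> xs \<in> M"
  using assms
proof (induction m arbitrary: xs)
  case (Suc m)
  obtain ys j where ys: "set ys \<subseteq> {1..<Suc m - 1}" and j: "j \<in> {1..Suc m}"
    and eq: "q (pos_eval (braid_group n) \<sigma> xs) =
      q (pos_eval (braid_group n) \<sigma> (ys @ rev [j..<Suc m]))"
    and perm: "perm_word n xs = perm_word n (ys @ rev [j..<Suc m])"
    using sigma_normal_form[OF Suc.prems(1-3)] .
  have "j = perm_word n (ys @ rev [j..<Suc m]) j" using perm Suc.prems(4) by simp
  also have "\<dots> = perm_word n ys (Suc m)"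
    unfolding perm_word_append using perm_word_descending[of j "Suc m" n] j by simp
  also have "\<dots> = Suc m" by (rule perm_word_fixes) (use ys in auto)
  finally have nf: "ys @ rev [j..<Suc m] = ys" by simp
  have "pos_eval (braid_group n) \<sigma> ys \<in> M"
  proof (cases "m = 0")
    case True
    then show ?thesis using ys M.one_closed by simp
  next
    case False
    then show ?thesis using Suc.IH[of ys] ys nf perm Suc.prems by simp
  qed
  then have "q (pos_eval (braid_group n) \<sigma> xs) = M"
    using eq nf M.rcos_const[OF B.group_axioms] by simp
  moreover have "set xs \<subseteq> {1..<n}" using Suc.prems by fastforce
  ultimately show ?case
    using B.coset_join1[OF _ pos_eval_sigma_closed M.subgroup_axioms] by blast
qed simp

lemma pure_braid_eq_twist_subgroup: "P = M"
proof
  show "P \<subseteq> M"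
  proof
    fix x assume "x \<in> P"
    then have x: "x \<in> carrier (braid_group n)" "\<pi> x = id"
      by (auto simp: pure_braid_def kernel_def sym_group_one)
    obtain xs where xs: "set xs \<subseteq> {1..<n}" "q x = q (pos_eval (braid_group n) \<sigma> xs)"
      "\<pi> x = perm_word n xs"
      using braid_coset_positive[OF x(1)] .
    have "pos_eval (braid_group n) \<sigma> xs \<in> M"
      using pure_word_in_twist_subgroup[OF xs(1)] n xs(3) x(2) by simp
    then have "q x = M" using xs(2) M.rcos_const[OF B.group_axioms] by simp
    then show "x \<in> M" using B.coset_join1[OF _ x(1) M.subgroup_axioms] by blast
  qed
qed (rule twist_subgroup_pure)

text \<open>
  Applying the normal form twice, a braid is a word \<open>zs\<close> in \<open>\<sigma>\<^sub>1, \<dots>, \<sigma>\<^bsub>n-3\<^esub>\<close> followed by the runs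
  \<open>\<sigma>\<^bsub>n-2\<^esub> \<dots> \<sigma>\<^sub>l\<close> and \<open>\<sigma>\<^bsub>n-1\<^esub> \<dots> \<sigma>\<^sub>j\<close>, up to a pure factor. If it preserves the last two
  positions, then the first run is empty and the second is empty or \<open>\<sigma>\<^bsub>n-1\<^esub>\<close>, and everything left
  commutes with \<open>\<sigma>\<^bsub>n-1\<^esub>\<close>.
\<close>

lemma last_pair_stabilizer:
  assumes k: "k \<in> carrier (braid_group n)" and stab: "\<pi> k ` {n - 1, n} = {n - 1, n}"
  obtains m w where "m \<in> P" "w \<in> carrier (braid_group n)" "k = m \<cdot> w" "w \<cdot> \<sigma> (n - 1) = \<sigma> (n - 1) \<cdot> w"
proof -
  obtain xs where xs: "set xs \<subseteq> {1..<n}" "q k = q (pos_eval (braid_group n) \<sigma> xs)"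
    "\<pi> k = perm_word n xs"
    using braid_coset_positive[OF k] .
  have n1: "1 \<le> n" "1 \<le> n - 1" "n - 1 \<le> n" using n by auto
  obtain ys j where ys: "set ys \<subseteq> {1..<n - 1}" and j: "j \<in> {1..n}"
    and eq1: "q (pos_eval (braid_group n) \<sigma> xs) = q (pos_eval (braid_group n) \<sigma> (ys @ rev [j..<n]))"
    and perm1: "perm_word n xs = perm_word n (ys @ rev [j..<n])"
    using sigma_normal_form[OF xs(1) n1(1) order_refl] .
  obtain zs l where zs: "set zs \<subseteq> {1..<n - 1 - 1}" and l: "l \<in> {1..n - 1}"
    and eq2: "q (pos_eval (braid_group n) \<sigma> ys) = q (pos_eval (braid_group n) \<sigma> (zs @ rev [l..<n - 1]))"
    and perm2: "perm_word n ys = perm_word n (zs @ rev [l..<n - 1])"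
    using sigma_normal_form[OF ys n1(2,3)] .
  have inj: "inj (\<pi> k)"
    using perm.hom_closed[OF k] by (auto simp: sym_group_carrier dest: permutes_inj)
  have "perm_word n ys n = n" by (rule perm_word_fixes) (use ys in fastforce)
  then have pj: "\<pi> k j = n"
    unfolding xs(3) perm1 perm_word_append comp_apply
    using perm_word_descending[of j n n] j by simp
  have "j \<in> {n - 1, n}"
  proof -
    have "n \<in> \<pi> k ` {n - 1, n}" unfolding stab by simp
    then obtain j' where "n = \<pi> k j'" "j' \<in> {n - 1, n}" by (rule imageE)
    then show ?thesis using pj injD[OF inj, of j j'] by simp
  qed
  have "perm_word n zs (n - 1) = n - 1" by (rule perm_word_fixes) (use zs in fastforce)
  then have pl: "perm_word n ys l = n - 1"
    unfolding perm2 perm_word_append comp_apply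
    using perm_word_descending[of l "n - 1" n] l by simp
  \<comment> \<open>\<open>a\<close> is the other element of the pair. Both \<open>k\<close> and the run send it to \<open>n - 1\<close>, so \<open>ys\<close> fixes
    \<open>n - 1\<close>.\<close>
  define a where "a = (if j = n then n - 1 else n)"
  have pa: "\<pi> k a = n - 1"
  proof -
    have a: "a \<in> {n - 1, n}" "a \<noteq> j" using n \<open>j \<in> {n - 1, n}\<close> by (auto simp: a_def)
    have "\<pi> k a \<in> {n - 1, n}" using imageI[OF a(1), of "\<pi> k"] unfolding stab .
    moreover have "\<pi> k a \<noteq> n" using a(2) pj injD[OF inj, of a j] by auto
    ultimately show ?thesis by simp
  qed
  have last: "[n - 1..<n] = [n - 1]" using n upt_conv_Cons[of "n - 1" n] by simp
  have ra: "perm_word n (rev [j..<n]) a = n - 1"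
  proof (cases "j = n")
    case False
    then have "rev [j..<n] = [n - 1]" using \<open>j \<in> {n - 1, n}\<close> last by auto
    then show ?thesis using False n by (simp add: a_def sym_group_mult sym_group_one)
  qed (simp add: a_def sym_group_one)
  have "perm_word n ys (n - 1) = n - 1"
    using pa ra unfolding xs(3) perm1 perm_word_append comp_apply by simp
  moreover have "inj (perm_word n ys)"
  proof -
    have "pos_eval (braid_group n) \<sigma> ys \<in> carrier (braid_group n)"
      by (rule pos_eval_sigma_closed) (use ys in fastforce)
    moreover have "\<pi> (pos_eval (braid_group n) \<sigma> ys) = perm_word n ys"
      by (rule braid_perm_pos_eval) (use ys in fastforce)
    ultimately show ?thesis
      using perm.hom_closed by (metis sym_group_carrier permutes_inj)
  qed
  ultimately have "l = n - 1" using pl injD[of "perm_word n ys" l "n - 1"] by simp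
  then have nf2: "zs @ rev [l..<n - 1] = zs" by simp
  define ws where "ws = zs @ rev [j..<n]"
  have ws_cases: "set (rev [j..<n]) \<subseteq> {n - 1}"
    using \<open>j \<in> {n - 1, n}\<close> by auto
  have sets: "set ys \<subseteq> {1..<n}" "set zs \<subseteq> {1..<n}" "set (rev [j..<n]) \<subseteq> {1..<n}"
    using ys zs j by fastforce+
  then have ws: "set ws \<subseteq> {1..<n}" by (simp add: ws_def)
  define w where "w = pos_eval (braid_group n) \<sigma> ws"
  have w: "w \<in> carrier (braid_group n)" unfolding w_def using ws by (rule pos_eval_sigma_closed)
  have "q k = q (pos_eval (braid_group n) \<sigma> ys \<cdot> pos_eval (braid_group n) \<sigma> (rev [j..<n]))"
    unfolding xs(2) eq1 using sets braid_sigma_closed by (subst B.pos_eval_append) auto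
  also have "\<dots> = q (pos_eval (braid_group n) \<sigma> zs \<cdot> pos_eval (braid_group n) \<sigma> (rev [j..<n]))"
    using eq2 sets pos_eval_sigma_closed unfolding nf2 by (simp add: q.hom_mult del: mult_FactGroup)
  also have "\<dots> = q w"
    unfolding w_def ws_def using sets braid_sigma_closed by (subst B.pos_eval_append) auto
  finally obtain m where m: "m \<in> M" "k = m \<cdot> w"
    using B.cosets_eqE[OF M.subgroup_axioms k w] by blast
  have "\<sigma> (n - 1) \<cdot> w = w \<cdot> \<sigma> (n - 1)"
    unfolding w_def
  proof (rule B.pos_eval_commute)
    fix y assume "y \<in> set ws"
    then have "y \<in> set zs \<or> y = n - 1" using ws_cases by (auto simp: ws_def)
    then show "\<sigma> (n - 1) \<cdot> \<sigma> y = \<sigma> y \<cdot> \<sigma> (n - 1)"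
      using braid_sigma_commute[of y n "n - 1"] zs n by fastforce
  qed (use ws n braid_sigma_closed in auto)
  then show ?thesis
    using that[of m w] m w pure_braid_eq_twist_subgroup by simp
qed

end

section \<open>Linking numbers of braids\<close>

definition braid_link :: "nat \<Rightarrow> nat word set \<Rightarrow> (nat \<Rightarrow> nat \<Rightarrow> int) \<times> (nat \<Rightarrow> nat)" where
  "braid_link n x = vlink n (braid_to_vbraid n x)"

lemma group_hom_braid_link: "group_hom (braid_group n) (link_group n) (braid_link n)"
  unfolding braid_link_def[abs_def]
  by (rule group_hom_comp[OF group_hom_braid_to_vbraid group_hom_vlink])

lemma braid_link_sigma:
  "i \<in> {1..n-1} \<Longrightarrow>
   braid_link n (braid_sigma n i) = (\<lambda>a b. of_bool (a = i \<and> b = i + 1), transpose i (i + 1))"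
  by (simp add: braid_link_def braid_to_vbraid_sigma vlink_gens)

lemma vbraid_perm_braid_to_vbraid:
  assumes "x \<in> carrier (braid_group n)"
  shows "vbraid_perm n (braid_to_vbraid n x) = braid_perm n x"
proof -
  have "group_hom (braid_group n) (sym_group n) (\<lambda>x. vbraid_perm n (braid_to_vbraid n x))"
    by (rule group_hom_comp[OF group_hom_braid_to_vbraid group_hom_vbraid_perm])
  moreover have "vbraid_perm n (braid_to_vbraid n (gen_class (braid_gens n) (braid_rels n) i)) =
      braid_perm n (gen_class (braid_gens n) (braid_rels n) i)" if "i \<in> braid_gens n" for i
    using that braid_to_vbraid_sigma[of i n] vbraid_perm_gens[of i n] braid_perm_sigma[of i n]
    by (simp add: braid_gens_def braid_sigma_def)
  ultimately show ?thesis
    using pres_hom_ext group_hom_braid_perm[of n] assms unfolding braid_group_def by blast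
qed

lemma snd_braid_link:
  assumes "x \<in> carrier (braid_group n)"
  shows "snd (braid_link n x) = braid_perm n x"
  using assms group_hom.hom_closed[OF group_hom_braid_to_vbraid]
  by (simp add: braid_link_def snd_vlink vbraid_perm_braid_to_vbraid)

lemma pure_braid_iff:
  "x \<in> pure_braid n \<longleftrightarrow> x \<in> carrier (braid_group n) \<and> snd (braid_link n x) = id"
  by (auto simp: pure_braid_def kernel_def sym_group_one snd_braid_link)

text \<open>
  A full twist conjugated by \<open>g\<close> links exactly the two strands that \<open>g\<close> brings from the last two
  positions, once in either order. Comparing both sides of \<open>band_twist n g \<cdot> g = g \<cdot> \<sigma>\<^bsub>n-1\<^esub>\<^sup>2\<close> cancels
  the linking numbers of \<open>g\<close> without computing those of its inverse.
\<close>

lemma braid_link_band_twist: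
  assumes n: "n \<ge> 2" and g: "g \<in> carrier (braid_group n)"
  shows "fst (braid_link n (band_twist n g)) a b = of_bool ({a, b} = braid_perm n g ` {n - 1, n})"
proof -
  let ?B = "braid_group n"
  interpret lk: group_hom ?B "link_group n" "braid_link n" by (rule group_hom_braid_link)
  interpret perm: group_hom ?B "sym_group n" "braid_perm n" by (rule group_hom_braid_perm)
  define t where "t = braid_sigma n (n - 1) \<otimes>\<^bsub>?B\<^esub> braid_sigma n (n - 1)"
  have s: "braid_sigma n (n - 1) \<in> carrier ?B" by (rule sigma_last_closed[OF n])
  have t: "t \<in> carrier ?B" using s by (simp add: t_def)
  have T: "band_twist n g \<in> carrier ?B" by (rule band_twist_closed[OF n g])
  have lt: "braid_link n t = (\<lambda>a b. of_bool ({a, b} = {n - 1, n}), id)"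
    using n s by (auto simp: t_def braid_link_sigma link_group_mult fun_eq_iff transpose_def
        doubleton_eq_iff)
  have "band_twist n g \<otimes>\<^bsub>?B\<^esub> g = g \<otimes>\<^bsub>?B\<^esub> t"
    unfolding band_twist_def t_def[symmetric] using g t by (simp add: lk.G.m_assoc)
  then have "braid_link n (band_twist n g) \<otimes>\<^bsub>link_group n\<^esub> braid_link n g =
      braid_link n g \<otimes>\<^bsub>link_group n\<^esub> braid_link n t"
    using g t T by (simp flip: lk.hom_mult)
  then have *: "fst (braid_link n (band_twist n g)) (braid_perm n g c) (braid_perm n g d) =
      of_bool ({c, d} = {n - 1, n})" for c d
    using g by (simp add: link_group_mult lt snd_braid_link fun_eq_iff)
  have p: "braid_perm n g permutes {1..n}"
    using perm.hom_closed[OF g] by (simp add: sym_group_carrier)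
  obtain c d where "a = braid_perm n g c" "b = braid_perm n g d"
    using permutes_surj[OF p] by (metis surjD)
  moreover have "{braid_perm n g c, braid_perm n g d} = braid_perm n g ` {n - 1, n} \<longleftrightarrow>
      {c, d} = {n - 1, n}"
    using inj_image_eq_iff[OF permutes_inj[OF p], of "{c, d}" "{n - 1, n}"] by simp
  ultimately show ?thesis using * by simp
qed

section \<open>The abelianized pure braid group\<close>

lemma (in group) comm_group_Mod_derived:
  assumes "subgroup H G"
  shows "comm_group (G\<lparr>carrier := H\<rparr> Mod derived G H)"
    and "group_hom (G\<lparr>carrier := H\<rparr>) (G\<lparr>carrier := H\<rparr> Mod derived G H) (\<lambda>x. derived G H #> x)"
proof -
  interpret H: group "G\<lparr>carrier := H\<rparr>" by (rule subgroup_imp_group[OF assms])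
  have d: "derived (G\<lparr>carrier := H\<rparr>) H = derived G H"
    by (rule derived_consistent[OF _ assms]) simp
  show "comm_group (G\<lparr>carrier := H\<rparr> Mod derived G H)"
    using H.derived_quot_is_comm_group by (simp add: d)
  interpret D: normal "derived G H" "G\<lparr>carrier := H\<rparr>"
    using H.derived_self_is_normal by (simp add: d)
  show "group_hom (G\<lparr>carrier := H\<rparr>) (G\<lparr>carrier := H\<rparr> Mod derived G H) (\<lambda>x. derived G H #> x)"
    using D.r_coset_hom_Mod D.factorgroup_is_group H.group_axioms
    by (simp add: group_hom_def group_hom_axioms_def r_coset_def)
qed

lemma (in comm_group) conj_eq:
  "x \<in> carrier G \<Longrightarrow> y \<in> carrier G \<Longrightarrow> x \<otimes> y \<otimes> inv x = y"
  by (simp add: m_comm[of x y] m_assoc)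

text \<open>
  In the abelianized pure braid group a full twist depends on the pair of strands only: two
  conjugators \<open>g\<close> and \<open>h\<close> with the same pair differ by a braid that preserves the last two positions.
  Up to a braid commuting with \<open>\<sigma>\<^bsub>n-1\<^esub>\<close> this is a pure braid, and conjugation by pure braids is
  invisible in the abelianization.
\<close>

lemma band_twist_coset_eq:
  assumes n: "n \<ge> 2" and g: "g \<in> carrier (braid_group n)" and h: "h \<in> carrier (braid_group n)"
    and pair: "braid_perm n g ` {n - 1, n} = braid_perm n h ` {n - 1, n}"
  shows "derived (braid_group n) (pure_braid n) #>\<^bsub>braid_group n\<^esub> band_twist n g =
    derived (braid_group n) (pure_braid n) #>\<^bsub>braid_group n\<^esub> band_twist n h"
proof -
  let ?B = "braid_group n" and ?P = "pure_braid n"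
  let ?K = "?B\<lparr>carrier := ?P\<rparr>" and ?D = "derived ?B ?P"
  let ?s = "braid_sigma n (n - 1)" and ?F = "\<lambda>x. ?D #>\<^bsub>?B\<^esub> x"
  interpret B: group ?B by (rule group_braid_group)
  interpret perm: group_hom ?B "sym_group n" "braid_perm n" by (rule group_hom_braid_perm)
  interpret P: normal ?P ?B by (rule pure_braid_normal[OF n])
  interpret A: comm_group "?K Mod ?D"
    by (rule B.comm_group_Mod_derived[OF P.subgroup_axioms])
  interpret F: group_hom ?K "?K Mod ?D" ?F
    by (rule B.comm_group_Mod_derived[OF P.subgroup_axioms])
  have s: "?s \<in> carrier ?B" by (rule sigma_last_closed[OF n])
  define k where "k = inv\<^bsub>?B\<^esub> h \<otimes>\<^bsub>?B\<^esub> g"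
  have k: "k \<in> carrier ?B" "g = h \<otimes>\<^bsub>?B\<^esub> k" using g h by (auto simp: k_def simp flip: B.m_assoc)
  have "braid_perm n g = braid_perm n h \<circ> braid_perm n k"
    using h k by (simp add: sym_group_mult)
  moreover have "inj (braid_perm n h)"
    using perm.hom_closed[OF h] by (auto simp: sym_group_carrier dest: permutes_inj)
  ultimately have "braid_perm n k ` {n - 1, n} = {n - 1, n}"
    using pair by (metis image_comp inj_image_eq_iff)
  then obtain m w where m: "m \<in> ?P" and w: "w \<in> carrier ?B" and kmw: "k = m \<otimes>\<^bsub>?B\<^esub> w"
    and comm: "w \<otimes>\<^bsub>?B\<^esub> ?s = ?s \<otimes>\<^bsub>?B\<^esub> w"
    using last_pair_stabilizer[OF n k(1)] by metis
  define u where "u = h \<otimes>\<^bsub>?B\<^esub> m \<otimes>\<^bsub>?B\<^esub> inv\<^bsub>?B\<^esub> h"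
  have u: "u \<in> ?P" unfolding u_def by (rule P.conj_closed[OF m h])
  have mc: "m \<in> carrier ?B" and uc: "u \<in> carrier ?B" using m u P.subset by auto
  have "w \<otimes>\<^bsub>?B\<^esub> (?s \<otimes>\<^bsub>?B\<^esub> ?s) = ?s \<otimes>\<^bsub>?B\<^esub> ?s \<otimes>\<^bsub>?B\<^esub> w"
    using comm w s by (metis B.m_assoc)
  then have fix_w: "w \<otimes>\<^bsub>?B\<^esub> (?s \<otimes>\<^bsub>?B\<^esub> ?s) \<otimes>\<^bsub>?B\<^esub> inv\<^bsub>?B\<^esub> w = ?s \<otimes>\<^bsub>?B\<^esub> ?s"
    using w s by (simp add: B.m_assoc)
  have "g = u \<otimes>\<^bsub>?B\<^esub> (h \<otimes>\<^bsub>?B\<^esub> w)"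
    unfolding k(2) kmw u_def using h mc w by (simp add: B.m_assoc B.inv_solve_left)
  then have "band_twist n g = u \<otimes>\<^bsub>?B\<^esub> (h \<otimes>\<^bsub>?B\<^esub>
      (w \<otimes>\<^bsub>?B\<^esub> (?s \<otimes>\<^bsub>?B\<^esub> ?s) \<otimes>\<^bsub>?B\<^esub> inv\<^bsub>?B\<^esub> w) \<otimes>\<^bsub>?B\<^esub> inv\<^bsub>?B\<^esub> h) \<otimes>\<^bsub>?B\<^esub> inv\<^bsub>?B\<^esub> u"
    using uc h w s by (simp add: band_twist_def B.conj_conj)
  then have tw: "band_twist n g = u \<otimes>\<^bsub>?B\<^esub> band_twist n h \<otimes>\<^bsub>?B\<^esub> inv\<^bsub>?B\<^esub> u"
    unfolding fix_w band_twist_def .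
  have hP: "band_twist n h \<in> ?P" by (rule band_twist_pure[OF n h])
  have "?F (band_twist n g) = ?F (u \<otimes>\<^bsub>?K\<^esub> band_twist n h \<otimes>\<^bsub>?K\<^esub> inv\<^bsub>?K\<^esub> u)"
    using tw u B.m_inv_consistent[OF P.subgroup_axioms u] by simp
  also have "\<dots> = ?F u \<otimes>\<^bsub>?K Mod ?D\<^esub> ?F (band_twist n h) \<otimes>\<^bsub>?K Mod ?D\<^esub> inv\<^bsub>?K Mod ?D\<^esub> ?F u"
  proof -
    have c: "u \<in> carrier ?K" "band_twist n h \<in> carrier ?K" using u hP by auto
    show ?thesis
      by (simp only: F.hom_mult[OF F.G.m_closed[OF c] F.G.inv_closed[OF c(1)]]
          F.hom_mult[OF c] F.hom_inv[OF c(1)])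
  qed
  also have "\<dots> = ?F (band_twist n h)"
    using u hP by (intro A.conj_eq F.hom_closed) auto
  finally show ?thesis .
qed

text \<open>
  The full twists generate the pure braid group, and their linking numbers are the unit vectors
  indexed by unordered pairs of strands, so the linking numbers are coordinates in the abelianization.
\<close>

lemma linking_numbers_detect_derived:
  assumes n: "n \<ge> 2" and x: "x \<in> carrier (braid_group n)"
    and lk: "braid_link n x = \<one>\<^bsub>link_group n\<^esub>"
  shows "x \<in> derived (braid_group n) (pure_braid n)"
proof -
  let ?B = "braid_group n" and ?P = "pure_braid n"
  let ?K = "?B\<lparr>carrier := ?P\<rparr>" and ?D = "derived ?B ?P"
  interpret B: group ?B by (rule group_braid_group)
  interpret lk: group_hom ?B "link_group n" "braid_link n" by (rule group_hom_braid_link)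
  interpret perm: group_hom ?B "sym_group n" "braid_perm n" by (rule group_hom_braid_perm)
  interpret P: normal ?P ?B by (rule pure_braid_normal[OF n])
  have perm_pure: "snd (braid_link n y) = id" "y \<in> carrier ?B" if "y \<in> ?P" for y
    using that unfolding pure_braid_iff by blast+
  have xP: "x \<in> ?P"
    unfolding pure_braid_iff using x lk by (simp add: link_group_one)
  define e where "e = (\<lambda>y (a, b). fst (braid_link n y) a b)"
  \<comment> \<open>An unordered pair of strands is encoded as an increasing pair, so that each twist has one nonzero
    coordinate instead of two.\<close>
  define p where "p = (\<lambda>g. (min (braid_perm n g (n - 1)) (braid_perm n g n),
      max (braid_perm n g (n - 1)) (braid_perm n g n)))"
  have ord: "fst (p g) \<le> snd (p g)" for g by (simp add: p_def)
  have pair: "braid_perm n g ` {n - 1, n} = {fst (p g), snd (p g)}" for g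
    by (cases "braid_perm n g (n - 1) \<le> braid_perm n g n")
      (simp_all add: p_def min_def max_def insert_commute)
  have range: "p g \<in> {1..n} \<times> {1..n}" if "g \<in> carrier ?B" for g
  proof -
    have perm: "braid_perm n g permutes {1..n}"
      using perm.hom_closed[OF that] by (simp add: sym_group_carrier)
    have "braid_perm n g (n - 1) \<in> {1..n}" "braid_perm n g n \<in> {1..n}"
      unfolding permutes_in_image[OF perm] using n by simp_all
    then show ?thesis by (simp add: p_def min_le_iff_disj le_max_iff_disj)
  qed
  have "?D #>\<^bsub>?B\<^esub> x = \<one>\<^bsub>?K Mod ?D\<^esub>"
  proof (rule hom_eq_one_if_coordinates_zero[where K = ?K and t = "band_twist n"
        and I = "carrier ?B" and e = e and p = p])
    show "group_hom ?K (?K Mod ?D) (\<lambda>x. ?D #>\<^bsub>?B\<^esub> x)" "comm_group (?K Mod ?D)"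
      by (rule B.comm_group_Mod_derived[OF P.subgroup_axioms])+
    show tP: "band_twist n ` carrier ?B \<subseteq> carrier ?K"
      using band_twist_pure[OF n] by auto
    show "carrier ?K = generate ?K (band_twist n ` carrier ?B)"
      using tP B.generate_consistent[OF _ P.subgroup_axioms] pure_braid_eq_twist_subgroup[OF n]
      by (simp add: twist_subgroup_def)
    show "e (y \<otimes>\<^bsub>?K\<^esub> z) j = e y j + e z j" if "y \<in> carrier ?K" "z \<in> carrier ?K" for y z j
      using that perm_pure by (cases j) (simp add: e_def link_group_mult)
    show "finite (p ` carrier ?B)"
      by (rule finite_subset[OF image_subsetI[OF range]]) simp_all
    show "e (band_twist n g) j = of_bool (j = p g)"
      if "g \<in> carrier ?B" "j \<in> p ` carrier ?B" for g j
    proof -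
      from that(2) obtain h where "j = p h" by blast
      moreover obtain a b where j: "j = (a, b)" by (cases j)
      ultimately have "a \<le> b" using ord[of h] by (metis fst_conv snd_conv)
      then have "{a, b} = {fst (p g), snd (p g)} \<longleftrightarrow> j = p g"
        using ord[of g] by (cases "p g") (auto simp: j doubleton_eq_iff)
      then show ?thesis
        using braid_link_band_twist[OF n that(1)] pair by (simp add: e_def j)
    qed
    show "?D #>\<^bsub>?B\<^esub> band_twist n g = ?D #>\<^bsub>?B\<^esub> band_twist n h"
      if "g \<in> carrier ?B" "h \<in> carrier ?B" "p g = p h" for g h
      using that pair by (intro band_twist_coset_eq[OF n]) auto
  qed (use xP lk in \<open>auto simp: e_def link_group_one\<close>)
  then show ?thesis
    using B.coset_join1[OF _ x] B.derived_is_subgroup[of ?P] P.subset by simp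
qed

section \<open>The induced embedding\<close>

text \<open>
  The map \<open>x \<mapsto> N f(x)\<close> to the quotient has kernel \<open>D\<close>, so this is the first isomorphism theorem
  applied to it.
\<close>

lemma quotient_mon_if_preimage_eq:
  assumes f: "group_hom G H f" and N: "N \<lhd> H"
    and D: "D = {x \<in> carrier G. f x \<in> N}"
  shows "\<exists>\<phi> \<in> mon (G Mod D) (H Mod N). \<forall>x \<in> carrier G. \<phi> (D #>\<^bsub>G\<^esub> x) = N #>\<^bsub>H\<^esub> f x"
proof -
  interpret f: group_hom G H f by (rule f)
  interpret N: normal N H by (rule N)
  define h where "h = (\<lambda>x. N #>\<^bsub>H\<^esub> f x)"
  have "group_hom H (H Mod N) (\<lambda>y. N #>\<^bsub>H\<^esub> y)"
    using N.r_coset_hom_Mod N.factorgroup_is_group f.H.group_axioms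
    by (simp add: group_hom_def group_hom_axioms_def)
  then interpret h: group_hom G "H Mod N" h
    unfolding h_def by (rule group_hom_comp[OF f])
  have ker: "kernel G (H Mod N) h = D"
    unfolding D kernel_def h_def
    using f.H.coset_join1[OF _ f.hom_closed N.subgroup_axioms]
      f.H.coset_join2[OF f.hom_closed N.subgroup_axioms] by auto
  define \<phi> where "\<phi> = (\<lambda>X. the_elem (h ` X))"
  have "\<phi> \<in> mon (G Mod D) (H Mod N)"
    using h.FactGroup_hom h.FactGroup_inj_on by (simp add: mon_def \<phi>_def ker)
  moreover have "\<phi> (D #>\<^bsub>G\<^esub> x) = N #>\<^bsub>H\<^esub> f x" if x: "x \<in> carrier G" for x
  proof -
    have "h ` (D #>\<^bsub>G\<^esub> x) = {h x}"
    proof -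
      have "h (d \<otimes>\<^bsub>G\<^esub> x) = h x" if "d \<in> D" for d
        using that x h.hom_closed[OF x] unfolding ker[symmetric] kernel_def
        by (simp del: mult_FactGroup one_FactGroup)
      moreover have "x \<in> D #>\<^bsub>G\<^esub> x"
        using f.G.rcos_self[OF x] h.subgroup_kernel ker by simp
      ultimately show ?thesis by (force simp: r_coset_def)
    qed
    then show ?thesis by (simp add: \<phi>_def h_def)
  qed
  ultimately show ?thesis by blast
qed

theorem proposition3p4:
  fixes n :: nat
  assumes "n \<ge> 2"
  shows "\<exists>\<phi> \<in> mon (braid_group n Mod derived (braid_group n) (pure_braid n))
                 (vbraid_group n Mod derived (vbraid_group n) (pure_vbraid n)).
           \<forall>x \<in> carrier (braid_group n).
             \<phi> (derived (braid_group n) (pure_braid n) #>\<^bsub>braid_group n\<^esub> x) =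
             derived (vbraid_group n) (pure_vbraid n) #>\<^bsub>vbraid_group n\<^esub> braid_to_vbraid n x"
proof (rule quotient_mon_if_preimage_eq[OF group_hom_braid_to_vbraid derived_pure_vbraid_normal])
  let ?B = "braid_group n" and ?V = "vbraid_group n" and ?\<iota> = "braid_to_vbraid n"
  interpret \<iota>: group_hom ?B ?V ?\<iota> by (rule group_hom_braid_to_vbraid)
  have P: "pure_braid n \<subseteq> carrier ?B" and VP: "pure_vbraid n \<subseteq> carrier ?V"
    by (auto simp: pure_braid_def pure_vbraid_def kernel_def)
  show "derived ?B (pure_braid n) = {x \<in> carrier ?B. ?\<iota> x \<in> derived ?V (pure_vbraid n)}"
  proof (intro equalityI subsetI)
    fix x assume x: "x \<in> derived ?B (pure_braid n)"
    have "?\<iota> ` pure_braid n \<subseteq> pure_vbraid n"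
      by (auto simp: pure_braid_def pure_vbraid_def kernel_def vbraid_perm_braid_to_vbraid)
    then have "derived ?V (?\<iota> ` pure_braid n) \<subseteq> derived ?V (pure_vbraid n)"
      by (rule \<iota>.H.mono_derived)
    then show "x \<in> {x \<in> carrier ?B. ?\<iota> x \<in> derived ?V (pure_vbraid n)}"
      using x \<iota>.derived_img[OF P] \<iota>.G.derived_in_carrier[OF P] by auto
  next
    fix x assume "x \<in> {x \<in> carrier ?B. ?\<iota> x \<in> derived ?V (pure_vbraid n)}"
    then show "x \<in> derived ?B (pure_braid n)"
      using linking_numbers_detect_derived[OF assms] vlink_derived_pure by (simp add: braid_link_def)
  qed
qed

end
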